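(* Let $\Gamma$ be a set of second-order formulas (a context) and $A$ a second-order formula, and let $k\in\{i,c\}$. If $\Gamma\vdash^2_k A$, then $\Gamma^*,SC_1\vdash^1_k A^*$.
   Context: The second-order language $\mathcal L_2$ has logical symbols $\bot,\to,\wedge,\vee,\forall,\exists$; a countable set $\mathcal V$ of first-order variables; a countable set $\Sigma$ of function symbols (constants have arity $0$), from which terms are built; and for each $n\in\mathbb N$ a countable set $\mathcal V_n$ of second-order variables of arity $n$. Its atomic formulas are $\bot$ and $X^n(t_1,\dots,t_n)$, and it has quantification over first-order variables and over second-order variables of every arity. The first-order language $\mathcal L_1$ has the same $\mathcal V$, $\Sigma$ and logical symbols, and for each $n\in\mathbb N$ one relation symbol $\mathrm{Ap}_n$ of arity $n+1$ (and no others). $\mathrm{Free}(F)$ denotes the set of free variables, and $F\leftrightarrow G$ abbreviates $(F\to G)\wedge(G\to F)$. $\Gamma\vdash^n_k F$ denotes natural-deduction derivability, in first-order logic over $\mathcal L_1$ for $n=1$ and in second-order logic over $\mathcal L_2$ for $n=2$ (where second-order $\forall$-elimination and $\exists$-introduction instantiate $X^n$ by an arbitrary abstraction $\lambda x_1\dots x_n\,G$); the logic is intuitionistic for $k=i$ and classical for $k=c$. Fix for each $n$ a bijection $\phi_n:\mathcal V_n\to\mathcal V$. The coding $F\mapsto F^*$ of $\mathcal L_2$-formulas into $\mathcal L_1$-formulas is defined by: - $\bot^*=\bot$ and $(X^n(t_1,\dots,t_n))^*=\mathrm{Ap}_n(\phi_n(X^n),t_1,\dots,t_n)$. - $(A\diamond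 B)^*=A^*\diamond B^*$ for $\diamond\in\{\to,\wedge,\vee\}$. - $(Qx\,A)^*=Qy\,(A[x:=y])^*$ for a variable $y\notin\mathrm{Free}(A^* )$. - $(QX^n\,A)^*=Qy\,(A[X^n:=Y^n])^*$, where $\phi_n(Y^n)=y$ and $y\notin\mathrm{Free}(A^* )$. Here $Q\in\{\forall,\exists\}$. For a set of formulas, $\Gamma^*=\{F^*:F\in\Gamma\}$. $SC_2$ is the set of all closed $\mathcal L_2$-formulas $\forall\chi_1\dots\forall\chi_m\,\exists X^n\,\forall x_1\dots\forall x_n\,(G\leftrightarrow X^n(x_1,\dots,x_n))$, where $x_j\in\mathcal V$, the $\chi_j$ are first- or second-order variables, $\mathrm{Free}(G)\subseteq\{x_1,\dots,x_n,\chi_1,\dots,\chi_m\}$, and $X^n\notin\mathrm{Free}(G)$. Finally, $SC_1=\{F^*:F\in SC_2\}$. *)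

theory Defs
  imports "HOL-Library.Countable"
begin

section \<open>Variables and terms\<close>

type_synonym var = nat

text \<open>First-order variables, and second-order variables of each arity, form countably infinite
  sets, represented by copies of \<open>nat\<close>. Those of arity \<open>n\<close> are \<open>{X. arity X = n}\<close>.\<close>

datatype svar = SVar (arity: nat) (idx: nat)

datatype lvar = FO var | SO svar

datatype 'f trm = Var var | Fun 'f "'f trm list"

text \<open>A signature is a partial function: its domain is the set of function symbols, its values
  are their arities.\<close>

type_synonym 'f sig = "'f \<rightharpoonup> nat"

primrec is_trm :: "'f sig \<Rightarrow> 'f trm \<Rightarrow> bool" where
  "is_trm S (Var x) = True"
| "is_trm S (Fun f ts) = (S f = Some (length ts) \<and> list_all (is_trm S) ts)"

primrec vars :: "'f trm \<Rightarrow> var set" where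
  "vars (Var x) = {x}"
| "vars (Fun f ts) = \<Union>(set (map vars ts))"

primrec tsubst :: "(var \<Rightarrow> 'f trm) \<Rightarrow> 'f trm \<Rightarrow> 'f trm" where
  "tsubst \<sigma> (Var x) = \<sigma> x"
| "tsubst \<sigma> (Fun f ts) = Fun f (map (tsubst \<sigma>) ts)"

datatype logic = Intuitionistic | Classical


section \<open>First-order logic\<close>

datatype 'f fm1 =
    Bot1
  | Ap nat "'f trm list"
  | Imp1 "'f fm1" "'f fm1"
  | And1 "'f fm1" "'f fm1"
  | Or1 "'f fm1" "'f fm1"
  | All1 var "'f fm1"
  | Ex1 var "'f fm1"

primrec is_fm1 :: "'f sig \<Rightarrow> 'f fm1 \<Rightarrow> bool" where
  "is_fm1 S Bot1 = True"
| "is_fm1 S (Ap n ts) = (length ts = n + 1 \<and> list_all (is_trm S) ts)"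
| "is_fm1 S (Imp1 A B) = (is_fm1 S A \<and> is_fm1 S B)"
| "is_fm1 S (And1 A B) = (is_fm1 S A \<and> is_fm1 S B)"
| "is_fm1 S (Or1 A B) = (is_fm1 S A \<and> is_fm1 S B)"
| "is_fm1 S (All1 x A) = is_fm1 S A"
| "is_fm1 S (Ex1 x A) = is_fm1 S A"

primrec Free1 :: "'f fm1 \<Rightarrow> var set" where
  "Free1 Bot1 = {}"
| "Free1 (Ap n ts) = \<Union>(vars ` set ts)"
| "Free1 (Imp1 A B) = Free1 A \<union> Free1 B"
| "Free1 (And1 A B) = Free1 A \<union> Free1 B"
| "Free1 (Or1 A B) = Free1 A \<union> Free1 B"
| "Free1 (All1 x A) = Free1 A - {x}"
| "Free1 (Ex1 x A) = Free1 A - {x}"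

definition new1 :: "var set \<Rightarrow> var" where
  "new1 U = (SOME y. y \<notin> U)"

text \<open>Simultaneous capture-avoiding substitution. A bound variable is always replaced by a new
  one that depends only on the variables to be avoided; thus substitution is defined by structural
  recursion, and results are correct up to renaming of bound variables.\<close>

primrec subst1 :: "(var \<Rightarrow> 'f trm) \<Rightarrow> 'f fm1 \<Rightarrow> 'f fm1" where
  "subst1 \<sigma> Bot1 = Bot1"
| "subst1 \<sigma> (Ap n ts) = Ap n (map (tsubst \<sigma>) ts)"
| "subst1 \<sigma> (Imp1 A B) = Imp1 (subst1 \<sigma> A) (subst1 \<sigma> B)"
| "subst1 \<sigma> (And1 A B) = And1 (subst1 \<sigma> A) (subst1 \<sigma> B)"
| "subst1 \<sigma> (Or1 A B) = Or1 (subst1 \<sigma> A) (subst1 \<sigma> B)"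
| "subst1 \<sigma> (All1 x A) =
    (let y = new1 (\<Union>z\<in>Free1 A - {x}. vars (\<sigma> z)) in All1 y (subst1 (\<sigma>(x := Var y)) A))"
| "subst1 \<sigma> (Ex1 x A) =
    (let y = new1 (\<Union>z\<in>Free1 A - {x}. vars (\<sigma> z)) in Ex1 y (subst1 (\<sigma>(x := Var y)) A))"

text \<open>Contexts may be infinite. The rule \<open>Weak1\<close> makes the eigenvariable conditions
  refer only to the hypotheses that are actually used, as in derivation trees.\<close>

inductive nd1 :: "'f sig \<Rightarrow> logic \<Rightarrow> 'f fm1 set \<Rightarrow> 'f fm1 \<Rightarrow> bool" for S k where
  Assm1: "A \<in> \<Gamma> \<Longrightarrow> is_fm1 S A \<Longrightarrow> nd1 S k \<Gamma> A"
| Weak1: "nd1 S k \<Gamma> A \<Longrightarrow> \<Gamma> \<subseteq> \<Delta> \<Longrightarrow> nd1 S k \<Delta> A"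
| BotE1: "nd1 S k \<Gamma> Bot1 \<Longrightarrow> is_fm1 S A \<Longrightarrow> nd1 S k \<Gamma> A"
| RAA1: "k = Classical \<Longrightarrow> nd1 S k (insert (Imp1 A Bot1) \<Gamma>) Bot1 \<Longrightarrow> is_fm1 S A \<Longrightarrow> nd1 S k \<Gamma> A"
| ImpI1: "nd1 S k (insert A \<Gamma>) B \<Longrightarrow> is_fm1 S A \<Longrightarrow> nd1 S k \<Gamma> (Imp1 A B)"
| ImpE1: "nd1 S k \<Gamma> (Imp1 A B) \<Longrightarrow> nd1 S k \<Gamma> A \<Longrightarrow> nd1 S k \<Gamma> B"
| AndI1: "nd1 S k \<Gamma> A \<Longrightarrow> nd1 S k \<Gamma> B \<Longrightarrow> nd1 S k \<Gamma> (And1 A B)"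
| AndE1l: "nd1 S k \<Gamma> (And1 A B) \<Longrightarrow> nd1 S k \<Gamma> A"
| AndE1r: "nd1 S k \<Gamma> (And1 A B) \<Longrightarrow> nd1 S k \<Gamma> B"
| OrI1l: "nd1 S k \<Gamma> A \<Longrightarrow> is_fm1 S B \<Longrightarrow> nd1 S k \<Gamma> (Or1 A B)"
| OrI1r: "nd1 S k \<Gamma> B \<Longrightarrow> is_fm1 S A \<Longrightarrow> nd1 S k \<Gamma> (Or1 A B)"
| OrE1: "nd1 S k \<Gamma> (Or1 A B) \<Longrightarrow> nd1 S k (insert A \<Gamma>) C \<Longrightarrow> nd1 S k (insert B \<Gamma>) C \<Longrightarrow> nd1 S k \<Gamma> C"
| AllI1: "nd1 S k \<Gamma> A \<Longrightarrow> x \<notin> \<Union>(Free1 ` \<Gamma>) \<Longrightarrow> nd1 S k \<Gamma> (All1 x A)"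
| AllE1: "nd1 S k \<Gamma> (All1 x A) \<Longrightarrow> is_trm S t \<Longrightarrow> nd1 S k \<Gamma> (subst1 (Var(x := t)) A)"
| ExI1: "nd1 S k \<Gamma> (subst1 (Var(x := t)) A) \<Longrightarrow> is_trm S t \<Longrightarrow> is_fm1 S A \<Longrightarrow> nd1 S k \<Gamma> (Ex1 x A)"
| ExE1: "nd1 S k \<Gamma> (Ex1 x A) \<Longrightarrow> nd1 S k (insert A \<Gamma>) C \<Longrightarrow>
    x \<notin> \<Union>(Free1 ` \<Gamma>) \<union> Free1 C \<Longrightarrow> nd1 S k \<Gamma> C"


section \<open>Second-order logic\<close>

datatype 'f fm2 =
    Bot2
  | Atom svar "'f trm list"
  | Imp2 "'f fm2" "'f fm2"
  | And2 "'f fm2" "'f fm2"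
  | Or2 "'f fm2" "'f fm2"
  | All2 lvar "'f fm2"
  | Ex2 lvar "'f fm2"

definition Iff2 :: "'f fm2 \<Rightarrow> 'f fm2 \<Rightarrow> 'f fm2" where
  "Iff2 A B = And2 (Imp2 A B) (Imp2 B A)"

definition Alls2 :: "lvar list \<Rightarrow> 'f fm2 \<Rightarrow> 'f fm2" where
  "Alls2 \<chi>s A = foldr All2 \<chi>s A"

primrec is_fm2 :: "'f sig \<Rightarrow> 'f fm2 \<Rightarrow> bool" where
  "is_fm2 S Bot2 = True"
| "is_fm2 S (Atom X ts) = (length ts = arity X \<and> list_all (is_trm S) ts)"
| "is_fm2 S (Imp2 A B) = (is_fm2 S A \<and> is_fm2 S B)"
| "is_fm2 S (And2 A B) = (is_fm2 S A \<and> is_fm2 S B)"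
| "is_fm2 S (Or2 A B) = (is_fm2 S A \<and> is_fm2 S B)"
| "is_fm2 S (All2 \<chi> A) = is_fm2 S A"
| "is_fm2 S (Ex2 \<chi> A) = is_fm2 S A"

primrec Free2 :: "'f fm2 \<Rightarrow> lvar set" where
  "Free2 Bot2 = {}"
| "Free2 (Atom X ts) = insert (SO X) (FO ` \<Union>(vars ` set ts))"
| "Free2 (Imp2 A B) = Free2 A \<union> Free2 B"
| "Free2 (And2 A B) = Free2 A \<union> Free2 B"
| "Free2 (Or2 A B) = Free2 A \<union> Free2 B"
| "Free2 (All2 \<chi> A) = Free2 A - {\<chi>}"
| "Free2 (Ex2 \<chi> A) = Free2 A - {\<chi>}"

text \<open>A second-order variable is replaced either by a variable or by an abstraction
  \<open>\<lambda>x\<^sub>1 \<dots> x\<^sub>n. G\<close>.\<close>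

datatype 'f inst = Sv svar | Lam "var list" "'f fm2"

primrec Free_inst :: "'f inst \<Rightarrow> lvar set" where
  "Free_inst (Sv Y) = {SO Y}"
| "Free_inst (Lam xs G) = Free2 G - FO ` set xs"

primrec image_vars :: "(var \<Rightarrow> 'f trm) \<Rightarrow> (svar \<Rightarrow> 'f inst) \<Rightarrow> lvar \<Rightarrow> lvar set" where
  "image_vars \<sigma> \<theta> (FO z) = FO ` vars (\<sigma> z)"
| "image_vars \<sigma> \<theta> (SO Z) = Free_inst (\<theta> Z)"

definition new_fo :: "lvar set \<Rightarrow> var" where
  "new_fo U = (SOME y. FO y \<notin> U)"

definition new_so :: "nat \<Rightarrow> lvar set \<Rightarrow> svar" where
  "new_so n U = (SOME Y. arity Y = n \<and> SO Y \<notin> U)"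

text \<open>First-order substitution; it cannot capture second-order variables.\<close>

primrec fsubst :: "(var \<Rightarrow> 'f trm) \<Rightarrow> 'f fm2 \<Rightarrow> 'f fm2" where
  "fsubst \<sigma> Bot2 = Bot2"
| "fsubst \<sigma> (Atom X ts) = Atom X (map (tsubst \<sigma>) ts)"
| "fsubst \<sigma> (Imp2 A B) = Imp2 (fsubst \<sigma> A) (fsubst \<sigma> B)"
| "fsubst \<sigma> (And2 A B) = And2 (fsubst \<sigma> A) (fsubst \<sigma> B)"
| "fsubst \<sigma> (Or2 A B) = Or2 (fsubst \<sigma> A) (fsubst \<sigma> B)"
| "fsubst \<sigma> (All2 \<chi> A) = (case \<chi> of
      FO x \<Rightarrow> let y = new_fo (\<Union>\<zeta>\<in>Free2 A - {FO x}. image_vars \<sigma> Sv \<zeta>)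
              in All2 (FO y) (fsubst (\<sigma>(x := Var y)) A)
    | SO X \<Rightarrow> All2 (SO X) (fsubst \<sigma> A))"
| "fsubst \<sigma> (Ex2 \<chi> A) = (case \<chi> of
      FO x \<Rightarrow> let y = new_fo (\<Union>\<zeta>\<in>Free2 A - {FO x}. image_vars \<sigma> Sv \<zeta>)
              in Ex2 (FO y) (fsubst (\<sigma>(x := Var y)) A)
    | SO X \<Rightarrow> Ex2 (SO X) (fsubst \<sigma> A))"

primrec inst_app :: "'f inst \<Rightarrow> 'f trm list \<Rightarrow> 'f fm2" where
  "inst_app (Sv Y) ts = Atom Y ts"
| "inst_app (Lam xs G) ts =
    fsubst (\<lambda>z. case map_of (zip xs ts) z of Some t \<Rightarrow> t | None \<Rightarrow> Var z) G"

primrec subst2 :: "(var \<Rightarrow> 'f trm) \<Rightarrow> (svar \<Rightarrow> 'f inst) \<Rightarrow> 'f fm2 \<Rightarrow> 'f fm2" where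
  "subst2 \<sigma> \<theta> Bot2 = Bot2"
| "subst2 \<sigma> \<theta> (Atom X ts) = inst_app (\<theta> X) (map (tsubst \<sigma>) ts)"
| "subst2 \<sigma> \<theta> (Imp2 A B) = Imp2 (subst2 \<sigma> \<theta> A) (subst2 \<sigma> \<theta> B)"
| "subst2 \<sigma> \<theta> (And2 A B) = And2 (subst2 \<sigma> \<theta> A) (subst2 \<sigma> \<theta> B)"
| "subst2 \<sigma> \<theta> (Or2 A B) = Or2 (subst2 \<sigma> \<theta> A) (subst2 \<sigma> \<theta> B)"
| "subst2 \<sigma> \<theta> (All2 \<chi> A) = (let U = (\<Union>\<zeta>\<in>Free2 A - {\<chi>}. image_vars \<sigma> \<theta> \<zeta>) in case \<chi> of
      FO x \<Rightarrow> let y = new_fo U in All2 (FO y) (subst2 (\<sigma>(x := Var y)) \<theta> A)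
    | SO X \<Rightarrow> let Y = new_so (arity X) U in All2 (SO Y) (subst2 \<sigma> (\<theta>(X := Sv Y)) A))"
| "subst2 \<sigma> \<theta> (Ex2 \<chi> A) = (let U = (\<Union>\<zeta>\<in>Free2 A - {\<chi>}. image_vars \<sigma> \<theta> \<zeta>) in case \<chi> of
      FO x \<Rightarrow> let y = new_fo U in Ex2 (FO y) (subst2 (\<sigma>(x := Var y)) \<theta> A)
    | SO X \<Rightarrow> let Y = new_so (arity X) U in Ex2 (SO Y) (subst2 \<sigma> (\<theta>(X := Sv Y)) A))"

definition fo_inst :: "var \<Rightarrow> 'f trm \<Rightarrow> 'f fm2 \<Rightarrow> 'f fm2" where
  "fo_inst x t A = fsubst (Var(x := t)) A"

definition so_inst :: "svar \<Rightarrow> 'f inst \<Rightarrow> 'f fm2 \<Rightarrow> 'f fm2" where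
  "so_inst X T A = subst2 Var (Sv(X := T)) A"

inductive nd2 :: "'f sig \<Rightarrow> logic \<Rightarrow> 'f fm2 set \<Rightarrow> 'f fm2 \<Rightarrow> bool" for S k where
  Assm2: "A \<in> \<Gamma> \<Longrightarrow> is_fm2 S A \<Longrightarrow> nd2 S k \<Gamma> A"
| Weak2: "nd2 S k \<Gamma> A \<Longrightarrow> \<Gamma> \<subseteq> \<Delta> \<Longrightarrow> nd2 S k \<Delta> A"
| BotE2: "nd2 S k \<Gamma> Bot2 \<Longrightarrow> is_fm2 S A \<Longrightarrow> nd2 S k \<Gamma> A"
| RAA2: "k = Classical \<Longrightarrow> nd2 S k (insert (Imp2 A Bot2) \<Gamma>) Bot2 \<Longrightarrow> is_fm2 S A \<Longrightarrow> nd2 S k \<Gamma> A"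
| ImpI2: "nd2 S k (insert A \<Gamma>) B \<Longrightarrow> is_fm2 S A \<Longrightarrow> nd2 S k \<Gamma> (Imp2 A B)"
| ImpE2: "nd2 S k \<Gamma> (Imp2 A B) \<Longrightarrow> nd2 S k \<Gamma> A \<Longrightarrow> nd2 S k \<Gamma> B"
| AndI2: "nd2 S k \<Gamma> A \<Longrightarrow> nd2 S k \<Gamma> B \<Longrightarrow> nd2 S k \<Gamma> (And2 A B)"
| AndE2l: "nd2 S k \<Gamma> (And2 A B) \<Longrightarrow> nd2 S k \<Gamma> A"
| AndE2r: "nd2 S k \<Gamma> (And2 A B) \<Longrightarrow> nd2 S k \<Gamma> B"
| OrI2l: "nd2 S k \<Gamma> A \<Longrightarrow> is_fm2 S B \<Longrightarrow> nd2 S k \<Gamma> (Or2 A B)"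
| OrI2r: "nd2 S k \<Gamma> B \<Longrightarrow> is_fm2 S A \<Longrightarrow> nd2 S k \<Gamma> (Or2 A B)"
| OrE2: "nd2 S k \<Gamma> (Or2 A B) \<Longrightarrow> nd2 S k (insert A \<Gamma>) C \<Longrightarrow> nd2 S k (insert B \<Gamma>) C \<Longrightarrow> nd2 S k \<Gamma> C"
| AllI2: "nd2 S k \<Gamma> A \<Longrightarrow> \<chi> \<notin> \<Union>(Free2 ` \<Gamma>) \<Longrightarrow> nd2 S k \<Gamma> (All2 \<chi> A)"
| AllE2_fo: "nd2 S k \<Gamma> (All2 (FO x) A) \<Longrightarrow> is_trm S t \<Longrightarrow> nd2 S k \<Gamma> (fo_inst x t A)"
| AllE2_so: "nd2 S k \<Gamma> (All2 (SO X) A) \<Longrightarrow> is_fm2 S G \<Longrightarrow> distinct xs \<Longrightarrow> length xs = arity X \<Longrightarrow>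
    nd2 S k \<Gamma> (so_inst X (Lam xs G) A)"
| ExI2_fo: "nd2 S k \<Gamma> (fo_inst x t A) \<Longrightarrow> is_trm S t \<Longrightarrow> is_fm2 S A \<Longrightarrow> nd2 S k \<Gamma> (Ex2 (FO x) A)"
| ExI2_so: "nd2 S k \<Gamma> (so_inst X (Lam xs G) A) \<Longrightarrow> is_fm2 S G \<Longrightarrow> distinct xs \<Longrightarrow>
    length xs = arity X \<Longrightarrow> is_fm2 S A \<Longrightarrow> nd2 S k \<Gamma> (Ex2 (SO X) A)"
| ExE2: "nd2 S k \<Gamma> (Ex2 \<chi> A) \<Longrightarrow> nd2 S k (insert A \<Gamma>) C \<Longrightarrow>
    \<chi> \<notin> \<Union>(Free2 ` \<Gamma>) \<union> Free2 C \<Longrightarrow> nd2 S k \<Gamma> C"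


section \<open>The coding\<close>

text \<open>The logical complexity is invariant under the renamings used by the coding.\<close>

primrec complexity :: "'f fm2 \<Rightarrow> nat" where
  "complexity Bot2 = 0"
| "complexity (Atom X ts) = 0"
| "complexity (Imp2 A B) = Suc (complexity A + complexity B)"
| "complexity (And2 A B) = Suc (complexity A + complexity B)"
| "complexity (Or2 A B) = Suc (complexity A + complexity B)"
| "complexity (All2 \<chi> A) = Suc (complexity A)"
| "complexity (Ex2 \<chi> A) = Suc (complexity A)"

lemma complexity_fsubst: "complexity (fsubst \<sigma> A) = complexity A"
  by (induction A arbitrary: \<sigma>) (auto simp: Let_def split: lvar.split)

lemma complexity_subst2: "range \<theta> \<subseteq> range Sv \<Longrightarrow> complexity (subst2 \<sigma> \<theta> A) = complexity A"
proof (induction A arbitrary: \<sigma> \<theta>)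
  case (Atom X ts)
  then obtain Y where "\<theta> X = Sv Y" by blast
  then show ?case by simp
next
  case (All2 \<chi> A)
  have "range (\<theta>(X := Sv Y)) \<subseteq> range Sv" for X Y using All2.prems by auto
  then show ?case using All2 by (auto simp: Let_def split: lvar.split)
next
  case (Ex2 \<chi> A)
  have "range (\<theta>(X := Sv Y)) \<subseteq> range Sv" for X Y using Ex2.prems by auto
  then show ?case using Ex2 by (auto simp: Let_def split: lvar.split)
qed auto

lemma complexity_fo_inst [simp]: "complexity (fo_inst x t A) = complexity A"
  by (simp add: fo_inst_def complexity_fsubst)

lemma complexity_so_inst [simp]: "complexity (so_inst X (Sv Y) A) = complexity A"
  unfolding so_inst_def by (rule complexity_subst2) auto

definition decode :: "(nat \<Rightarrow> svar \<Rightarrow> var) \<Rightarrow> nat \<Rightarrow> var \<Rightarrow> svar" where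
  "decode \<phi> n y = inv_into {Y. arity Y = n} (\<phi> n) y"

text \<open>The choice of the bound variable \<open>y\<close> is immaterial: codings that choose differently agree
  up to renaming of bound variables.\<close>

function code :: "(nat \<Rightarrow> svar \<Rightarrow> var) \<Rightarrow> 'f fm2 \<Rightarrow> 'f fm1" where
  "code \<phi> Bot2 = Bot1"
| "code \<phi> (Atom X ts) = Ap (arity X) (Var (\<phi> (arity X) X) # ts)"
| "code \<phi> (Imp2 A B) = Imp1 (code \<phi> A) (code \<phi> B)"
| "code \<phi> (And2 A B) = And1 (code \<phi> A) (code \<phi> B)"
| "code \<phi> (Or2 A B) = Or1 (code \<phi> A) (code \<phi> B)"
| "code \<phi> (All2 (FO x) A) =
    (let y = new1 (Free1 (code \<phi> A)) in All1 y (code \<phi> (fo_inst x (Var y) A)))"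
| "code \<phi> (All2 (SO X) A) =
    (let y = new1 (Free1 (code \<phi> A))
     in All1 y (code \<phi> (so_inst X (Sv (decode \<phi> (arity X) y)) A)))"
| "code \<phi> (Ex2 (FO x) A) =
    (let y = new1 (Free1 (code \<phi> A)) in Ex1 y (code \<phi> (fo_inst x (Var y) A)))"
| "code \<phi> (Ex2 (SO X) A) =
    (let y = new1 (Free1 (code \<phi> A))
     in Ex1 y (code \<phi> (so_inst X (Sv (decode \<phi> (arity X) y)) A)))"
  by pat_completeness auto
termination
  by (relation "measure (\<lambda>(\<phi>, A). complexity A)") auto


section \<open>Comprehension\<close>

text \<open>The variables \<open>xs\<close> need not be distinct here; an instance with repetitions follows from
  those without.\<close>

definition SC2 :: "'f sig \<Rightarrow> 'f fm2 set" where
  "SC2 S = {F. \<exists>\<chi>s X xs G.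
     F = Alls2 \<chi>s (Ex2 (SO X) (Alls2 (map FO xs) (Iff2 G (Atom X (map Var xs))))) \<and>
     is_fm2 S F \<and> Free2 F = {} \<and>
     length xs = arity X \<and> Free2 G \<subseteq> FO ` set xs \<union> set \<chi>s \<and> SO X \<notin> Free2 G}"

definition SC1 :: "'f sig \<Rightarrow> (nat \<Rightarrow> svar \<Rightarrow> var) \<Rightarrow> 'f fm1 set" where
  "SC1 S \<phi> = code \<phi> ` SC2 S"

end

theory Submission
  imports Defs
begin

text \<open>
  The coding identifies a second-order variable \<open>X\<close> with the first-order variable \<open>\<phi> X\<close>, so a
  variable that satisfies an eigenvariable condition in a second-order derivation may violate it
  after coding. The induction therefore runs over a coding \<open>cod r\<close> relative to an arbitrary
  assignment \<open>r\<close> of terms to all free variables: at an eigenvariable, \<open>r\<close> is changed to a variable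
  that is new for the finitely many hypotheses in use. The given
  coding \<open>code \<phi>\<close> is one instance up to renaming of bound variables. The rules that instantiate \<open>X\<close> by
  \<open>\<lambda>xs. G\<close> are simulated by taking from comprehension an element \<open>y\<close> with
  \<open>\<forall>xs. G \<leftrightarrow> Ap(y, xs)\<close> and replacing equivalents inside \<open>A\<close>.
\<close>

section \<open>Renaming of bound variables\<close>

text \<open>Binders are interpreted as functions on terms, so bound variables have no names, and formulas
  with the same interpretation under all environments are those that agree up to renaming.\<close>

datatype 'f hoas =
    HBot
  | HAp nat "'f trm list"
  | HImp "'f hoas" "'f hoas"
  | HAnd "'f hoas" "'f hoas"
  | HOr "'f hoas" "'f hoas"
  | HAll "'f trm \<Rightarrow> 'f hoas"
  | HEx "'f trm \<Rightarrow> 'f hoas"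

primrec hoas1 :: "(var \<Rightarrow> 'f trm) \<Rightarrow> 'f fm1 \<Rightarrow> 'f hoas" where
  "hoas1 e Bot1 = HBot"
| "hoas1 e (Ap n ts) = HAp n (map (tsubst e) ts)"
| "hoas1 e (Imp1 A B) = HImp (hoas1 e A) (hoas1 e B)"
| "hoas1 e (And1 A B) = HAnd (hoas1 e A) (hoas1 e B)"
| "hoas1 e (Or1 A B) = HOr (hoas1 e A) (hoas1 e B)"
| "hoas1 e (All1 x A) = HAll (\<lambda>d. hoas1 (e(x := d)) A)"
| "hoas1 e (Ex1 x A) = HEx (\<lambda>d. hoas1 (e(x := d)) A)"

definition alpha :: "'f fm1 \<Rightarrow> 'f fm1 \<Rightarrow> bool" where
  "alpha A B \<longleftrightarrow> (\<forall>e. hoas1 e A = hoas1 e B)"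

lemma finite_vars [simp]: "finite (vars t)"
  by (induction t) auto

lemma finite_Free1 [simp]: "finite (Free1 A)"
  by (induction A) auto

lemma new1_fresh: "finite U \<Longrightarrow> new1 U \<notin> U"
  unfolding new1_def by (rule someI_ex) (rule ex_new_if_finite[OF infinite_UNIV_nat])

lemma tsubst_eq_iff: "tsubst e t = tsubst e' t \<longleftrightarrow> (\<forall>z\<in>vars t. e z = e' z)"
  by (induction t) auto

lemma tsubst_cong: "(\<And>z. z \<in> vars t \<Longrightarrow> e z = e' z) \<Longrightarrow> tsubst e t = tsubst e' t"
  by (simp add: tsubst_eq_iff)

lemma tsubst_upd_fresh [simp]: "y \<notin> vars t \<Longrightarrow> tsubst (e(y := d)) t = tsubst e t"
  by (rule tsubst_cong) auto

lemma tsubst_tsubst [simp]: "tsubst e (tsubst \<sigma> t) = tsubst (\<lambda>z. tsubst e (\<sigma> z)) t"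
  by (induction t) auto

lemma tsubst_Var [simp]: "tsubst Var t = t"
  by (induction t) (auto simp: map_idI)

lemma vars_tsubst: "vars (tsubst \<sigma> t) = (\<Union>z\<in>vars t. vars (\<sigma> z))"
  by (induction t) auto

lemma is_trm_tsubst: "(\<And>z. is_trm S (\<sigma> z)) \<Longrightarrow> is_trm S (tsubst \<sigma> t) = is_trm S t"
  by (induction t) (auto simp: list_all_iff)

text \<open>Bodies under a binder are compared at every argument \<open>d\<close>, so the bound
  variable drops out and exactly the free ones remain. The equivalence, and not only the congruence,
  makes free variables recoverable from an interpretation.\<close>

lemma hoas1_eq_iff: "hoas1 e A = hoas1 e' A \<longleftrightarrow> (\<forall>z\<in>Free1 A. e z = e' z)"
proof (induction A arbitrary: e e')
  case (Ap n ts)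
  show ?case by (auto simp: tsubst_eq_iff)
qed (auto simp: fun_eq_iff)

lemma hoas1_cong: "(\<And>z. z \<in> Free1 A \<Longrightarrow> e z = e' z) \<Longrightarrow> hoas1 e A = hoas1 e' A"
  by (simp add: hoas1_eq_iff)

text \<open>The variable that \<open>subst1\<close> picks for a binder avoids the images of the
  other free variables, so assigning \<open>d\<close> to it disturbs none of them, and its name
  vanishes under \<open>HAll\<close> or \<open>HEx\<close>.\<close>

lemma hoas1_subst1: "hoas1 e (subst1 \<sigma> A) = hoas1 (\<lambda>z. tsubst e (\<sigma> z)) A"
proof (induction A arbitrary: e \<sigma>)
  case (All1 x A)
  let ?U = "\<Union>z\<in>Free1 A - {x}. vars (\<sigma> z)"
  have "new1 ?U \<notin> ?U" by (rule new1_fresh) simp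
  then show ?case using All1 by (auto simp: Let_def intro!: hoas1_cong ext tsubst_cong)
next
  case (Ex1 x A)
  let ?U = "\<Union>z\<in>Free1 A - {x}. vars (\<sigma> z)"
  have "new1 ?U \<notin> ?U" by (rule new1_fresh) simp
  then show ?case using Ex1 by (auto simp: Let_def intro!: hoas1_cong ext tsubst_cong)
qed auto

lemma alpha_sym: "alpha A B \<Longrightarrow> alpha B A"
  by (simp add: alpha_def)

lemma alpha_Free1: "alpha A B \<Longrightarrow> Free1 A = Free1 B"
proof -
  have "z \<in> Free1 B" if "alpha A B" "z \<in> Free1 A" for A B z
  proof (rule ccontr)
    assume "z \<notin> Free1 B"
    \<comment> \<open>A variation of the identity environment at \<open>z\<close> alone: the
      interpretation of \<open>B\<close> cannot see it, while that of \<open>A\<close> must.\<close>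
    then have "hoas1 (Var(z := Var (Suc z))) B = hoas1 Var B" by (intro hoas1_cong) auto
    then have "hoas1 (Var(z := Var (Suc z))) A = hoas1 Var A" using that by (simp add: alpha_def)
    then show False using that by (auto simp: hoas1_eq_iff)
  qed
  then show "alpha A B \<Longrightarrow> Free1 A = Free1 B" by (blast dest: alpha_sym)
qed

text \<open>Two environments are needed because equal functions under a binder may come from
  different bound variables.\<close>

lemma is_fm1_hoas1:
  assumes "hoas1 e A = hoas1 e' B" "\<And>z. is_trm S (e z)" "\<And>z. is_trm S (e' z)"
  shows "is_fm1 S A = is_fm1 S B"
  using assms
proof (induction A arbitrary: B e e')
  case Bot1
  then show ?case by (cases B) auto
next
  case (Ap n ts)
  then obtain us where us: "B = Ap n us" "map (tsubst e) ts = map (tsubst e') us"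
    by (cases B) auto
  have "list_all (is_trm S) (map (tsubst e) ts) = list_all (is_trm S) ts"
    "list_all (is_trm S) (map (tsubst e') us) = list_all (is_trm S) us"
    using Ap.prems by (auto simp: list_all_iff is_trm_tsubst)
  moreover have "length ts = length us" using us(2) map_eq_imp_length_eq by blast
  ultimately show ?case using us by simp
next
  case (Imp1 A1 A2)
  then show ?case by (cases B) (auto; blast)+
next
  case (And1 A1 A2)
  then show ?case by (cases B) (auto; blast)+
next
  case (Or1 A1 A2)
  then show ?case by (cases B) (auto; blast)+
next
  case (All1 x A)
  then obtain y C where B: "B = All1 y C" "\<And>d. hoas1 (e(x := d)) A = hoas1 (e'(y := d)) C"
    by (cases B) (auto simp: fun_eq_iff)
  \<comment> \<open>Any well-formed argument leads below the binder; \<open>Var 0\<close> is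
    one.\<close>
  have "is_fm1 S A = is_fm1 S C"
    by (rule All1.IH[OF B(2)[of "Var 0"]]) (use All1.prems in auto)
  then show ?case using B by simp
next
  case (Ex1 x A)
  then obtain y C where B: "B = Ex1 y C" "\<And>d. hoas1 (e(x := d)) A = hoas1 (e'(y := d)) C"
    by (cases B) (auto simp: fun_eq_iff)
  have "is_fm1 S A = is_fm1 S C"
    by (rule Ex1.IH[OF B(2)[of "Var 0"]]) (use Ex1.prems in auto)
  then show ?case using B by simp
qed

lemma alpha_is_fm1: "alpha A B \<Longrightarrow> is_fm1 S A = is_fm1 S B"
  by (rule is_fm1_hoas1[of Var _ Var]) (auto simp: alpha_def)

section \<open>Well-formedness and cut in first-order derivations\<close>

lemma is_fm1_subst1: "is_fm1 S A \<Longrightarrow> (\<And>z. is_trm S (\<sigma> z)) \<Longrightarrow> is_fm1 S (subst1 \<sigma> A)"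
  by (induction A arbitrary: \<sigma>) (auto simp: Let_def list_all_iff is_trm_tsubst)

lemma nd1_is_fm1: "nd1 S k \<Gamma> A \<Longrightarrow> is_fm1 S A"
  by (induction rule: nd1.induct) (auto intro: is_fm1_subst1)

lemma nd1_cut:
  assumes "nd1 S k \<Gamma> A" "nd1 S k (insert A \<Gamma>) B"
  shows "nd1 S k \<Gamma> B"
  using assms ImpE1 ImpI1 nd1_is_fm1 by blast

lemma nd1_cuts:
  assumes "finite D" "nd1 S k (D \<union> \<Gamma>) A" "\<And>F. F \<in> D \<Longrightarrow> nd1 S k \<Gamma> F"
  shows "nd1 S k \<Gamma> A"
  using assms
proof (induction D rule: finite_induct)
  case (insert F D)
  have "nd1 S k (D \<union> \<Gamma>) F" using insert.prems(2)[of F] by (auto intro: Weak1)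
  then have "nd1 S k (D \<union> \<Gamma>) A" using insert.prems(1) by (auto intro: nd1_cut)
  then show ?case using insert by auto
qed auto

lemma nd1_Assm_insert: "is_fm1 S A \<Longrightarrow> nd1 S k (insert A \<Gamma>) A"
  by (rule Assm1) auto

section \<open>Derivability up to renaming of bound variables\<close>

primrec depth1 :: "'f fm1 \<Rightarrow> nat" where
  "depth1 Bot1 = 0"
| "depth1 (Ap n ts) = 0"
| "depth1 (Imp1 A B) = Suc (depth1 A + depth1 B)"
| "depth1 (And1 A B) = Suc (depth1 A + depth1 B)"
| "depth1 (Or1 A B) = Suc (depth1 A + depth1 B)"
| "depth1 (All1 x A) = Suc (depth1 A)"
| "depth1 (Ex1 x A) = Suc (depth1 A)"

lemma depth1_subst1 [simp]: "depth1 (subst1 \<sigma> A) = depth1 A"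
  by (induction A arbitrary: \<sigma>) (auto simp: Let_def)

lemma alpha_rename:
  assumes "\<And>e d. hoas1 (e(x := d)) A = hoas1 (e(y := d)) B"
  shows "alpha (subst1 (Var(x := Var y)) A) B"
  unfolding alpha_def
proof
  fix e :: "var \<Rightarrow> 'a trm"
  have "(\<lambda>z. tsubst e ((Var(x := Var y)) z)) = e(x := e y)" by auto
  then show "hoas1 e (subst1 (Var(x := Var y)) A) = hoas1 e B"
    using assms[of e "e y"] by (simp add: hoas1_subst1)
qed

text \<open>Implication is contravariant, so its antecedents exchange the roles of \<open>A\<close>
  and \<open>B\<close>; the induction is therefore on the sum of both depths. Depth is used rather
  than the subformula order because the quantifier cases pass to a substituted body.\<close>

lemma alpha_nd1_single:
  assumes "alpha A B" "is_fm1 S A"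
  shows "nd1 S k {A} B"
  using assms
proof (induction "depth1 A + depth1 B" arbitrary: A B rule: less_induct)
  case less
  have A: "nd1 S k {A} A" using less.prems by (auto intro: Assm1)
  have fmB: "is_fm1 S B" using less.prems alpha_is_fm1 by blast
  have eq: "\<And>e. hoas1 e A = hoas1 e B" using less.prems by (simp add: alpha_def)
  have step: "nd1 S k \<Gamma> D" if "nd1 S k \<Gamma> C" "alpha C D"
    "depth1 C + depth1 D < depth1 A + depth1 B" for C D \<Gamma>
  proof -
    have "nd1 S k {C} D" using less.hyps that nd1_is_fm1 by blast
    then have "nd1 S k (insert C \<Gamma>) D" by (rule Weak1) auto
    then show ?thesis using that nd1_cut by blast
  qed
  show ?case
  proof (cases A)
    case Bot1
    then show ?thesis using A fmB BotE1 by blast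
  next
    case (Ap n ts)
    then have "B = A" using eq[of Var] by (cases B) (auto simp: map_idI)
    then show ?thesis using A by simp
  next
    case (Imp1 C D)
    then obtain C' D' where B: "B = Imp1 C' D'" and al: "alpha C' C" "alpha D D'"
      using eq by (cases B) (auto simp: alpha_def)
    have "nd1 S k {C', A} C" by (rule step[OF _ al(1)]) (use B Imp1 fmB in \<open>auto intro: Assm1\<close>)
    moreover have "nd1 S k {C', A} (Imp1 C D)" using Imp1 less.prems by (auto intro: Assm1)
    ultimately have "nd1 S k {C', A} D" using ImpE1 by blast
    then have "nd1 S k {C', A} D'" by (rule step[OF _ al(2)]) (use B Imp1 in auto)
    then show ?thesis using B fmB by (auto intro: ImpI1)
  next
    case (And1 C D)
    then obtain C' D' where B: "B = And1 C' D'" and al: "alpha C C'" "alpha D D'"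
      using eq by (cases B) (auto simp: alpha_def)
    have "nd1 S k {A} C" "nd1 S k {A} D" using A And1 AndE1l AndE1r by blast+
    then have "nd1 S k {A} C'" "nd1 S k {A} D'"
      by (auto intro: step[OF _ al(1)] step[OF _ al(2)] simp: B And1)
    then show ?thesis using B AndI1 by blast
  next
    case (Or1 C D)
    then obtain C' D' where B: "B = Or1 C' D'" and al: "alpha C C'" "alpha D D'"
      using eq by (cases B) (auto simp: alpha_def)
    have "nd1 S k {C, A} C'"
      by (rule step[OF _ al(1)]) (use B Or1 less.prems in \<open>auto intro: Assm1\<close>)
    then have C: "nd1 S k {C, A} B" using B fmB by (auto intro: OrI1l)
    have "nd1 S k {D, A} D'"
      by (rule step[OF _ al(2)]) (use B Or1 less.prems in \<open>auto intro: Assm1\<close>)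
    then have D: "nd1 S k {D, A} B" using B fmB by (auto intro: OrI1r)
    show ?thesis using OrE1[OF _ C D] A Or1 by blast
  next
    case (All1 x C)
    then obtain y D where B: "B = All1 y D"
      and *: "\<And>e d. hoas1 (e(x := d)) C = hoas1 (e(y := d)) D"
      using eq by (cases B) (auto simp: fun_eq_iff)
    have "nd1 S k {A} (subst1 (Var(x := Var y)) C)" using A All1 by (auto intro: AllE1)
    then have D: "nd1 S k {A} D"
      by (rule step[OF _ alpha_rename]) (use * B All1 in auto)
    \<comment> \<open>Since \<open>A\<close> and \<open>B\<close> have the same free variables and
      \<open>B\<close> binds \<open>y\<close>, this \<open>y\<close> can serve as eigenvariable over
      the context \<open>{A}\<close>.\<close>
    have "y \<notin> Free1 A" using alpha_Free1[OF less.prems(1)] B by simp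
    then show ?thesis using AllI1[OF D, of y] B by simp
  next
    case (Ex1 x C)
    then obtain y D where B: "B = Ex1 y D"
      and *: "\<And>e d. hoas1 (e(x := d)) C = hoas1 (e(y := d)) D"
      using eq by (cases B) (auto simp: fun_eq_iff)
    have "nd1 S k {C, A} C" using Ex1 less.prems by (auto intro: Assm1)
    moreover have "alpha C (subst1 (Var(y := Var x)) D)"
      by (rule alpha_sym[OF alpha_rename]) (simp add: *)
    ultimately have "nd1 S k {C, A} (subst1 (Var(y := Var x)) D)"
      by (rule step) (use B Ex1 in auto)
    then have "nd1 S k {C, A} B" using B fmB by (auto intro: ExI1)
    moreover have "x \<notin> Free1 A" "x \<notin> Free1 B"
      using alpha_Free1[OF less.prems(1)] Ex1 by auto
    ultimately show ?thesis using ExE1[of S k "{A}" x C B] A Ex1 by auto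
  qed
qed

lemma alpha_nd1: "nd1 S k \<Gamma> A \<Longrightarrow> alpha A B \<Longrightarrow> nd1 S k \<Gamma> B"
  using nd1_cut[of S k \<Gamma> A B] alpha_nd1_single[of A B S k] nd1_is_fm1[of S k \<Gamma> A]
    Weak1[of S k "{A}" B "insert A \<Gamma>"] by auto

section \<open>The coding relative to an environment\<close>

text \<open>Where \<open>code\<close> renames inside the formula, here the environment is updated,
  which makes the recursion structural. Values are terms, so that instantiating a quantifier is an
  update as well.\<close>

primrec cod :: "(lvar \<Rightarrow> 'f trm) \<Rightarrow> 'f fm2 \<Rightarrow> 'f fm1" where
  "cod r Bot2 = Bot1"
| "cod r (Atom X ts) = Ap (arity X) (r (SO X) # map (tsubst (\<lambda>x. r (FO x))) ts)"
| "cod r (Imp2 A B) = Imp1 (cod r A) (cod r B)"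
| "cod r (And2 A B) = And1 (cod r A) (cod r B)"
| "cod r (Or2 A B) = Or1 (cod r A) (cod r B)"
| "cod r (All2 \<chi> A) =
    (let y = new1 (\<Union>\<zeta>\<in>Free2 A - {\<chi>}. vars (r \<zeta>)) in All1 y (cod (r(\<chi> := Var y)) A))"
| "cod r (Ex2 \<chi> A) =
    (let y = new1 (\<Union>\<zeta>\<in>Free2 A - {\<chi>}. vars (r \<zeta>)) in Ex1 y (cod (r(\<chi> := Var y)) A))"

text \<open>The nameless interpretation of the coded formula, read off directly from the
  second-order one. Binders of both sorts take a term, since a second-order variable is coded by an
  individual.\<close>

primrec hoas2 :: "(lvar \<Rightarrow> 'f trm) \<Rightarrow> 'f fm2 \<Rightarrow> 'f hoas" where
  "hoas2 r Bot2 = HBot"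
| "hoas2 r (Atom X ts) = HAp (arity X) (r (SO X) # map (tsubst (\<lambda>x. r (FO x))) ts)"
| "hoas2 r (Imp2 A B) = HImp (hoas2 r A) (hoas2 r B)"
| "hoas2 r (And2 A B) = HAnd (hoas2 r A) (hoas2 r B)"
| "hoas2 r (Or2 A B) = HOr (hoas2 r A) (hoas2 r B)"
| "hoas2 r (All2 \<chi> A) = HAll (\<lambda>d. hoas2 (r(\<chi> := d)) A)"
| "hoas2 r (Ex2 \<chi> A) = HEx (\<lambda>d. hoas2 (r(\<chi> := d)) A)"

lemma finite_Free2 [simp]: "finite (Free2 A)"
  by (induction A) auto

lemma finite_Free_inst [simp]: "finite (Free_inst T)"
  by (cases T) auto

lemma finite_image_vars [simp]: "finite (image_vars \<sigma> \<theta> \<zeta>)"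
  by (cases \<zeta>) auto

lemma new_fo_fresh: "finite U \<Longrightarrow> FO (new_fo U) \<notin> U"
proof -
  assume "finite U"
  then have "finite (FO -` U)" by (rule finite_vimageI) (auto simp: inj_on_def)
  then obtain y where "y \<notin> FO -` U" using ex_new_if_finite[OF infinite_UNIV_nat] by blast
  then have "\<exists>y. FO y \<notin> U" by auto
  then show ?thesis unfolding new_fo_def by (rule someI_ex)
qed

lemma new_so_fresh:
  assumes "finite U"
  shows "arity (new_so n U) = n \<and> SO (new_so n U) \<notin> U"
proof -
  have "finite ((\<lambda>i. SO (SVar n i)) -` U)"
    using assms by (rule finite_vimageI) (auto simp: inj_on_def)
  then obtain i where "i \<notin> (\<lambda>i. SO (SVar n i)) -` U"
    using ex_new_if_finite[OF infinite_UNIV_nat] by blast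
  then have "\<exists>Y. arity Y = n \<and> SO Y \<notin> U" by (intro exI[of _ "SVar n i"]) auto
  then show ?thesis unfolding new_so_def by (rule someI_ex)
qed

lemma cod_bound_fresh:
  "new1 (\<Union>\<zeta>\<in>Free2 A - {\<chi>}. vars (r \<zeta>)) \<notin> (\<Union>\<zeta>\<in>Free2 A - {\<chi>}. vars (r \<zeta>))"
  by (rule new1_fresh) simp

lemma cod_cong: "(\<And>\<zeta>. \<zeta> \<in> Free2 A \<Longrightarrow> r \<zeta> = r' \<zeta>) \<Longrightarrow> cod r A = cod r' A"
proof (induction A arbitrary: r r')
  case (Atom X ts)
  then show ?case by (auto intro!: tsubst_cong)
next
  case (All2 \<chi> A)
  then have "(\<Union>\<zeta>\<in>Free2 A - {\<chi>}. vars (r \<zeta>)) = (\<Union>\<zeta>\<in>Free2 A - {\<chi>}. vars (r' \<zeta>))" by auto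
  then show ?case by (auto simp: Let_def intro!: All2.IH All2.prems)
next
  case (Ex2 \<chi> A)
  then have "(\<Union>\<zeta>\<in>Free2 A - {\<chi>}. vars (r \<zeta>)) = (\<Union>\<zeta>\<in>Free2 A - {\<chi>}. vars (r' \<zeta>))" by auto
  then show ?case by (auto simp: Let_def intro!: Ex2.IH Ex2.prems)
next
  case (Imp2 A B)
  show ?case by (auto intro!: Imp2.IH Imp2.prems)
next
  case (And2 A B)
  show ?case by (auto intro!: And2.IH And2.prems)
next
  case (Or2 A B)
  show ?case by (auto intro!: Or2.IH Or2.prems)
qed simp

lemma hoas2_cong: "(\<And>\<zeta>. \<zeta> \<in> Free2 A \<Longrightarrow> r \<zeta> = r' \<zeta>) \<Longrightarrow> hoas2 r A = hoas2 r' A"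
proof (induction A arbitrary: r r')
  case (Atom X ts)
  then show ?case by (auto intro!: tsubst_cong)
next
  case (Imp2 A B)
  show ?case by (auto intro!: Imp2.IH Imp2.prems)
next
  case (And2 A B)
  show ?case by (auto intro!: And2.IH And2.prems)
next
  case (Or2 A B)
  show ?case by (auto intro!: Or2.IH Or2.prems)
next
  case (All2 \<chi> A)
  show ?case by (auto intro!: All2.IH ext simp: All2.prems)
next
  case (Ex2 \<chi> A)
  show ?case by (auto intro!: Ex2.IH ext simp: Ex2.prems)
qed simp

text \<open>The bound variable of \<open>cod\<close> is new for the values of the other free
  variables, so assigning \<open>d\<close> to it affects only \<open>\<chi>\<close>. Questions of
  renaming for \<open>cod\<close> thereby become equalities of \<open>hoas2\<close>.\<close>

lemma hoas1_cod: "hoas1 e (cod r A) = hoas2 (\<lambda>\<zeta>. tsubst e (r \<zeta>)) A"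
proof (induction A arbitrary: e r)
  case (All2 \<chi> A)
  then show ?case using cod_bound_fresh[of r A \<chi>]
    by (auto simp: Let_def intro!: hoas2_cong ext tsubst_cong)
next
  case (Ex2 \<chi> A)
  then show ?case using cod_bound_fresh[of r A \<chi>]
    by (auto simp: Let_def intro!: hoas2_cong ext tsubst_cong)
qed auto

lemma Free1_cod: "Free1 (cod r A) = (\<Union>\<zeta>\<in>Free2 A. vars (r \<zeta>))"
proof (induction A arbitrary: r)
  case (All2 \<chi> A)
  then show ?case using cod_bound_fresh[of r A \<chi>] by (auto simp: Let_def split: if_splits)
next
  case (Ex2 \<chi> A)
  then show ?case using cod_bound_fresh[of r A \<chi>] by (auto simp: Let_def split: if_splits)
qed (auto simp: vars_tsubst)

lemma is_fm1_cod: "(\<And>\<zeta>. is_trm S (r \<zeta>)) \<Longrightarrow> is_fm1 S (cod r A) = is_fm2 S A"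
  by (induction A arbitrary: r) (auto simp: Let_def list_all_iff is_trm_tsubst)

section \<open>Substitution as a change of environment\<close>

definition senv :: "(lvar \<Rightarrow> 'f trm) \<Rightarrow> (var \<Rightarrow> 'f trm) \<Rightarrow> lvar \<Rightarrow> 'f trm" where
  "senv r \<sigma> \<zeta> = (case \<zeta> of FO z \<Rightarrow> tsubst (\<lambda>x. r (FO x)) (\<sigma> z) | SO Z \<Rightarrow> r (SO Z))"

lemma senv_simps [simp]:
  "senv r \<sigma> (FO z) = tsubst (\<lambda>x. r (FO x)) (\<sigma> z)"
  "senv r \<sigma> (SO Z) = r (SO Z)"
  by (auto simp: senv_def)

lemma tsubst_FO_upd_fresh:
  "y \<notin> vars t \<Longrightarrow> tsubst (\<lambda>x. (r(FO y := d)) (FO x)) t = tsubst (\<lambda>x. r (FO x)) t"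
  by (rule tsubst_cong) auto

lemma senv_upd_FO:
  assumes "FO y \<notin> (\<Union>\<zeta>\<in>V - {FO x}. image_vars \<sigma> \<theta> \<zeta>)" "\<zeta> \<in> V"
  shows "senv (r(FO y := d)) (\<sigma>(x := Var y)) \<zeta> = ((senv r \<sigma>)(FO x := d)) \<zeta>"
proof (cases \<zeta>)
  case (FO z)
  show ?thesis
  proof (cases "z = x")
    case True
    then show ?thesis using FO by simp
  next
    case False
    then have "y \<notin> vars (\<sigma> z)" using assms FO by fastforce
    then show ?thesis using FO False tsubst_FO_upd_fresh[of y "\<sigma> z" r d] by simp
  qed
qed simp

lemma senv_upd_SO: "senv (r(SO X := d)) \<sigma> = (senv r \<sigma>)(SO X := d)"
proof
  fix \<zeta> show "senv (r(SO X := d)) \<sigma> \<zeta> = ((senv r \<sigma>)(SO X := d)) \<zeta>" by (cases \<zeta>) auto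
qed

lemma hoas2_fsubst: "hoas2 r (fsubst \<sigma> A) = hoas2 (senv r \<sigma>) A"
proof (induction A arbitrary: r \<sigma>)
  case (All2 \<chi> A)
  show ?case
  proof (cases \<chi>)
    case (FO x)
    let ?U = "\<Union>\<zeta>\<in>Free2 A - {FO x}. image_vars \<sigma> Sv \<zeta>"
    have fresh: "FO (new_fo ?U) \<notin> ?U" by (rule new_fo_fresh) simp
    have "hoas2 (senv (r(FO (new_fo ?U) := d)) (\<sigma>(x := Var (new_fo ?U)))) A
      = hoas2 ((senv r \<sigma>)(FO x := d)) A" for d
      by (rule hoas2_cong) (rule senv_upd_FO[OF fresh])
    then show ?thesis using FO by (simp add: Let_def All2.IH del: fun_upd_apply)
  next
    case (SO X)
    then show ?thesis by (simp add: All2.IH senv_upd_SO del: fun_upd_apply)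
  qed
next
  case (Ex2 \<chi> A)
  show ?case
  proof (cases \<chi>)
    case (FO x)
    let ?U = "\<Union>\<zeta>\<in>Free2 A - {FO x}. image_vars \<sigma> Sv \<zeta>"
    have fresh: "FO (new_fo ?U) \<notin> ?U" by (rule new_fo_fresh) simp
    have "hoas2 (senv (r(FO (new_fo ?U) := d)) (\<sigma>(x := Var (new_fo ?U)))) A
      = hoas2 ((senv r \<sigma>)(FO x := d)) A" for d
      by (rule hoas2_cong) (rule senv_upd_FO[OF fresh])
    then show ?thesis using FO by (simp add: Let_def Ex2.IH del: fun_upd_apply)
  next
    case (SO X)
    then show ?thesis by (simp add: Ex2.IH senv_upd_SO del: fun_upd_apply)
  qed
qed auto

text \<open>Packages both sorts of bound variable and both quantifiers, so that later inductions
  treat binders uniformly: \<open>\<chi>'\<close> is the renamed bound variable,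
  \<open>\<sigma>'\<close> and \<open>\<theta>'\<close> are the substitutions for the body. By the
  last clause no abstraction is introduced, so a condition on the lengths of parameter lists is
  inherited.\<close>

lemma subst2_binder:
  obtains \<chi>' \<sigma>' \<theta>' where
    "subst2 \<sigma> \<theta> (All2 \<chi> A) = All2 \<chi>' (subst2 \<sigma>' \<theta>' A)"
    "subst2 \<sigma> \<theta> (Ex2 \<chi> A) = Ex2 \<chi>' (subst2 \<sigma>' \<theta>' A)"
    "\<And>r d z. FO z \<in> Free2 A \<Longrightarrow> tsubst (\<lambda>x. (r(\<chi>' := d)) (FO x)) (\<sigma>' z)
      = (if FO z = \<chi> then d else tsubst (\<lambda>x. r (FO x)) (\<sigma> z))"
    "\<And>Z. SO Z = \<chi> \<Longrightarrow> \<exists>Y. \<chi>' = SO Y \<and> arity Y = arity Z \<and> \<theta>' Z = Sv Y"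
    "\<And>Z. SO Z \<in> Free2 A \<Longrightarrow> SO Z \<noteq> \<chi> \<Longrightarrow> \<theta>' Z = \<theta> Z \<and> \<chi>' \<notin> Free_inst (\<theta> Z)"
    "\<And>Z xs G. \<theta>' Z = Lam xs G \<Longrightarrow> \<theta> Z = Lam xs G"
proof -
  define U where "U = (\<Union>\<zeta>\<in>Free2 A - {\<chi>}. image_vars \<sigma> \<theta> \<zeta>)"
  have fin: "finite U" unfolding U_def by simp
  show thesis
  proof (cases \<chi>)
    case (FO x)
    define y where "y = new_fo U"
    have fresh: "FO y \<notin> U" using fin unfolding y_def by (rule new_fo_fresh)
    show thesis
    proof (rule that[of "FO y" "\<sigma>(x := Var y)" \<theta>])
      fix r :: "lvar \<Rightarrow> 'a trm" and d z assume "FO z \<in> Free2 A"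
      from senv_upd_FO[OF fresh[unfolded U_def FO] this, of r d]
      show "tsubst (\<lambda>x. (r(FO y := d)) (FO x)) ((\<sigma>(x := Var y)) z)
        = (if FO z = \<chi> then d else tsubst (\<lambda>x. r (FO x)) (\<sigma> z))"
        by (simp add: FO)
    next
      fix Z assume Z: "SO Z \<in> Free2 A" "SO Z \<noteq> \<chi>"
      then show "\<theta> Z = \<theta> Z \<and> FO y \<notin> Free_inst (\<theta> Z)" using fresh by (force simp: U_def)
    qed (simp_all add: Let_def y_def U_def FO)
  next
    case (SO X)
    define Y where "Y = new_so (arity X) U"
    have Y: "arity Y = arity X" "SO Y \<notin> U" using new_so_fresh[OF fin] by (auto simp: Y_def)
    show thesis
    proof (rule that[of "SO Y" \<sigma> "\<theta>(X := Sv Y)"])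
      fix Z assume Z: "SO Z \<in> Free2 A" "SO Z \<noteq> \<chi>"
      then have "SO Y \<notin> Free_inst (\<theta> Z)" using Y(2) by (force simp: U_def)
      then show "(\<theta>(X := Sv Y)) Z = \<theta> Z \<and> SO Y \<notin> Free_inst (\<theta> Z)" using Z SO by simp
    qed (auto simp: Let_def Y(1)[unfolded Y_def U_def SO] Y_def U_def SO split: if_splits)
  qed
qed

text \<open>Pure renamings of second-order variables give an equality. Abstractions will give only
  derivable equivalences, since \<open>Lam xs G\<close> has no term as its value.\<close>

lemma hoas2_subst2_Sv:
  assumes "\<And>z. FO z \<in> Free2 A \<Longrightarrow> r' (FO z) = tsubst (\<lambda>x. r (FO x)) (\<sigma> z)"
    and "\<And>Z. SO Z \<in> Free2 A \<Longrightarrow> \<exists>Y. \<theta> Z = Sv Y \<and> arity Y = arity Z \<and> r' (SO Z) = r (SO Y)"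
  shows "hoas2 r (subst2 \<sigma> \<theta> A) = hoas2 r' A"
  using assms
proof (induction A arbitrary: r r' \<sigma> \<theta>)
  case (Atom X ts)
  have "map (tsubst (\<lambda>x. r (FO x))) (map (tsubst \<sigma>) ts) = map (tsubst (\<lambda>x. r' (FO x))) ts"
    using Atom.prems(1)[symmetric] by (auto intro!: tsubst_cong)
  then show ?case using Atom.prems(2)[of X] by auto
next
  case (All2 \<chi> A)
  obtain \<chi>' \<sigma>' \<theta>' where b: "subst2 \<sigma> \<theta> (All2 \<chi> A) = All2 \<chi>' (subst2 \<sigma>' \<theta>' A)"
    "\<And>(r :: lvar \<Rightarrow> 'a trm) d z. FO z \<in> Free2 A \<Longrightarrow> tsubst (\<lambda>x. (r(\<chi>' := d)) (FO x)) (\<sigma>' z)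
      = (if FO z = \<chi> then d else tsubst (\<lambda>x. r (FO x)) (\<sigma> z))"
    "\<And>Z. SO Z = \<chi> \<Longrightarrow> \<exists>Y. \<chi>' = SO Y \<and> arity Y = arity Z \<and> \<theta>' Z = Sv Y"
    "\<And>Z. SO Z \<in> Free2 A \<Longrightarrow> SO Z \<noteq> \<chi> \<Longrightarrow> \<theta>' Z = \<theta> Z \<and> \<chi>' \<notin> Free_inst (\<theta> Z)"
    by (rule subst2_binder[of \<sigma> \<theta> \<chi> A]) blast
  have "hoas2 (r(\<chi>' := d)) (subst2 \<sigma>' \<theta>' A) = hoas2 (r'(\<chi> := d)) A" for d
  proof (rule All2.IH)
    show "(r'(\<chi> := d)) (FO z) = tsubst (\<lambda>x. (r(\<chi>' := d)) (FO x)) (\<sigma>' z)"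
      if "FO z \<in> Free2 A" for z
      using that All2.prems(1)[of z] by (simp add: b(2) del: fun_upd_apply) simp
    show "\<exists>Y. \<theta>' Z = Sv Y \<and> arity Y = arity Z \<and> (r'(\<chi> := d)) (SO Z) = (r(\<chi>' := d)) (SO Y)"
      if "SO Z \<in> Free2 A" for Z
      using that b(3)[of Z] b(4)[of Z] All2.prems(2)[of Z] by (cases "SO Z = \<chi>") fastforce+
  qed
  then show ?case by (simp add: b(1) del: fun_upd_apply subst2.simps)
next
  case (Ex2 \<chi> A)
  obtain \<chi>' \<sigma>' \<theta>' where b: "subst2 \<sigma> \<theta> (Ex2 \<chi> A) = Ex2 \<chi>' (subst2 \<sigma>' \<theta>' A)"
    "\<And>(r :: lvar \<Rightarrow> 'a trm) d z. FO z \<in> Free2 A \<Longrightarrow> tsubst (\<lambda>x. (r(\<chi>' := d)) (FO x)) (\<sigma>' z)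
      = (if FO z = \<chi> then d else tsubst (\<lambda>x. r (FO x)) (\<sigma> z))"
    "\<And>Z. SO Z = \<chi> \<Longrightarrow> \<exists>Y. \<chi>' = SO Y \<and> arity Y = arity Z \<and> \<theta>' Z = Sv Y"
    "\<And>Z. SO Z \<in> Free2 A \<Longrightarrow> SO Z \<noteq> \<chi> \<Longrightarrow> \<theta>' Z = \<theta> Z \<and> \<chi>' \<notin> Free_inst (\<theta> Z)"
    by (rule subst2_binder[of \<sigma> \<theta> \<chi> A]) blast
  have "hoas2 (r(\<chi>' := d)) (subst2 \<sigma>' \<theta>' A) = hoas2 (r'(\<chi> := d)) A" for d
  proof (rule Ex2.IH)
    show "(r'(\<chi> := d)) (FO z) = tsubst (\<lambda>x. (r(\<chi>' := d)) (FO x)) (\<sigma>' z)"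
      if "FO z \<in> Free2 A" for z
      using that Ex2.prems(1)[of z] by (simp add: b(2) del: fun_upd_apply) simp
    show "\<exists>Y. \<theta>' Z = Sv Y \<and> arity Y = arity Z \<and> (r'(\<chi> := d)) (SO Z) = (r(\<chi>' := d)) (SO Y)"
      if "SO Z \<in> Free2 A" for Z
      using that b(3)[of Z] b(4)[of Z] Ex2.prems(2)[of Z] by (cases "SO Z = \<chi>") fastforce+
  qed
  then show ?case by (simp add: b(1) del: fun_upd_apply subst2.simps)
qed (auto intro!: arg_cong2[where f = HImp] arg_cong2[where f = HAnd] arg_cong2[where f = HOr])

lemma hoas2_fo_inst:
  "hoas2 r (fo_inst x t A) = hoas2 (r(FO x := tsubst (\<lambda>z. r (FO z)) t)) A"
  unfolding fo_inst_def hoas2_fsubst by (rule hoas2_cong) (auto simp: senv_def split: lvar.split)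

lemma hoas2_so_inst_Sv:
  assumes "arity Y = arity X"
  shows "hoas2 r (so_inst X (Sv Y) A) = hoas2 (r(SO X := r (SO Y))) A"
  unfolding so_inst_def by (rule hoas2_subst2_Sv) (auto simp: assms)

section \<open>Quantifier rules for the relative coding\<close>

lemma cod_AllE:
  assumes "nd1 S k \<Gamma> (cod r (All2 \<chi> A))" "is_trm S t"
  shows "nd1 S k \<Gamma> (cod (r(\<chi> := t)) A)"
proof -
  define y where "y = new1 (\<Union>\<zeta>\<in>Free2 A - {\<chi>}. vars (r \<zeta>))"
  have y: "y \<notin> vars (r \<zeta>)" if "\<zeta> \<in> Free2 A" "\<zeta> \<noteq> \<chi>" for \<zeta>
    using cod_bound_fresh[of r A \<chi>] that by (auto simp: y_def)
  have "nd1 S k \<Gamma> (subst1 (Var(y := t)) (cod (r(\<chi> := Var y)) A))"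
    using assms by (intro AllE1) (simp_all add: Let_def y_def)
  moreover have "alpha (subst1 (Var(y := t)) (cod (r(\<chi> := Var y)) A)) (cod (r(\<chi> := t)) A)"
    unfolding alpha_def hoas1_subst1 hoas1_cod
    by (auto simp: y intro!: hoas2_cong tsubst_cong)
  ultimately show ?thesis by (rule alpha_nd1)
qed

lemma cod_ExI:
  assumes "nd1 S k \<Gamma> (cod (r(\<chi> := t)) A)" "is_trm S t" "\<And>\<zeta>. is_trm S (r \<zeta>)" "is_fm2 S A"
  shows "nd1 S k \<Gamma> (cod r (Ex2 \<chi> A))"
proof -
  define y where "y = new1 (\<Union>\<zeta>\<in>Free2 A - {\<chi>}. vars (r \<zeta>))"
  have y: "y \<notin> vars (r \<zeta>)" if "\<zeta> \<in> Free2 A" "\<zeta> \<noteq> \<chi>" for \<zeta>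
    using cod_bound_fresh[of r A \<chi>] that by (auto simp: y_def)
  have "alpha (cod (r(\<chi> := t)) A) (subst1 (Var(y := t)) (cod (r(\<chi> := Var y)) A))"
    unfolding alpha_def hoas1_subst1 hoas1_cod
    by (auto simp: y intro!: hoas2_cong tsubst_cong)
  then have "nd1 S k \<Gamma> (subst1 (Var(y := t)) (cod (r(\<chi> := Var y)) A))"
    by (rule alpha_nd1[OF assms(1)])
  then have "nd1 S k \<Gamma> (Ex1 y (cod (r(\<chi> := Var y)) A))"
    using assms(2-4) by (intro ExI1) (auto simp: is_fm1_cod)
  then show ?thesis by (simp add: Let_def y_def)
qed

text \<open>The bound variable chosen by \<open>cod\<close> may be free in \<open>\<Gamma>\<close>,
  so the quantifier is introduced over a separate eigenvariable \<open>y\<close> and then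
  renamed.\<close>

lemma cod_AllI:
  assumes "nd1 S k \<Gamma> (cod (r(\<chi> := Var y)) A)" "y \<notin> \<Union>(Free1 ` \<Gamma>)"
    "y \<notin> (\<Union>\<zeta>\<in>Free2 A - {\<chi>}. vars (r \<zeta>))"
  shows "nd1 S k \<Gamma> (cod r (All2 \<chi> A))"
proof (rule alpha_nd1)
  show "nd1 S k \<Gamma> (All1 y (cod (r(\<chi> := Var y)) A))" using assms by (intro AllI1)
  show "alpha (All1 y (cod (r(\<chi> := Var y)) A)) (cod r (All2 \<chi> A))"
    using assms(3) unfolding alpha_def hoas1_cod
    by (auto simp: hoas1_cod intro!: ext hoas2_cong tsubst_cong)
qed

lemma cod_ExE:
  assumes "nd1 S k \<Gamma> (cod r (Ex2 \<chi> A))" "nd1 S k (insert (cod (r(\<chi> := Var y)) A) \<Gamma>) C"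
    "y \<notin> \<Union>(Free1 ` \<Gamma>) \<union> Free1 C" "y \<notin> (\<Union>\<zeta>\<in>Free2 A - {\<chi>}. vars (r \<zeta>))"
  shows "nd1 S k \<Gamma> C"
proof -
  have "alpha (cod r (Ex2 \<chi> A)) (Ex1 y (cod (r(\<chi> := Var y)) A))"
    using assms(4) unfolding alpha_def hoas1_cod
    by (auto simp: hoas1_cod intro!: ext hoas2_cong tsubst_cong)
  then have "nd1 S k \<Gamma> (Ex1 y (cod (r(\<chi> := Var y)) A))" by (rule alpha_nd1[OF assms(1)])
  then show ?thesis using assms(2,3) by (rule ExE1)
qed

section \<open>The given coding as an instance of the relative one\<close>

definition cenv :: "(nat \<Rightarrow> svar \<Rightarrow> var) \<Rightarrow> lvar \<Rightarrow> 'f trm" where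
  "cenv \<phi> \<zeta> = Var (case \<zeta> of FO x \<Rightarrow> x | SO X \<Rightarrow> \<phi> (arity X) X)"

lemma decode:
  assumes "bij_betw (\<phi> n) {X. arity X = n} UNIV"
  shows "arity (decode \<phi> n y) = n" "\<phi> n (decode \<phi> n y) = y"
proof -
  have "y \<in> \<phi> n ` {X. arity X = n}" using assms by (simp add: bij_betw_def)
  then show "arity (decode \<phi> n y) = n" "\<phi> n (decode \<phi> n y) = y"
    using inv_into_into[of y "\<phi> n" "{X. arity X = n}"] f_inv_into_f[of y "\<phi> n"]
    by (auto simp: decode_def)
qed

text \<open>Induction is on \<open>complexity\<close> because \<open>code\<close> recurses into a
  renamed body. Renaming the bound variable and then reading the body under
  \<open>cenv \<phi>\<close> amounts to one update of the environment; \<open>quant\<close> shows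
  that nothing else changes.\<close>

lemma alpha_code:
  fixes A :: "'f fm2"
  assumes bij: "\<And>n. bij_betw (\<phi> n) {X. arity X = n} UNIV"
  shows "alpha (code \<phi> A) (cod (cenv \<phi>) A)"
proof (induction "complexity A" arbitrary: A rule: less_induct)
  case less
  have quant: "hoas2 ((\<lambda>\<zeta>. tsubst (e(y := d)) (cenv \<phi> \<zeta>))(\<chi> := d)) B
      = hoas2 ((\<lambda>\<zeta>. tsubst e (cenv \<phi> \<zeta>))(\<chi> := d)) B"
    if "complexity B < complexity A" "y = new1 (Free1 (code \<phi> B))" for B \<chi> y d and e :: "var \<Rightarrow> 'f trm"
  proof -
    \<comment> \<open>\<open>y\<close> avoids the codes of all free variables of \<open>B\<close>,
      whatever their sort or arity; hence setting \<open>y\<close> to \<open>d\<close> changes the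
      value of none of them.\<close>
    have "y \<notin> Free1 (code \<phi> B)" using that new1_fresh[of "Free1 (code \<phi> B)"] by simp
    then have "y \<notin> Free1 (cod (cenv \<phi>) B)" using less[OF that(1)] alpha_Free1 by blast
    then have "\<And>\<zeta>. \<zeta> \<in> Free2 B \<Longrightarrow> y \<notin> vars (cenv \<phi> \<zeta> :: 'f trm)" by (auto simp: Free1_cod)
    then show ?thesis by (intro hoas2_cong) simp
  qed
  have IH: "hoas1 e (code \<phi> B) = hoas2 (\<lambda>\<zeta>. tsubst e (cenv \<phi> \<zeta>)) B"
    if "complexity B < complexity A" for B :: "'f fm2" and e
    using less[OF that] by (simp add: alpha_def hoas1_cod)
  have "hoas1 e (code \<phi> A) = hoas2 (\<lambda>\<zeta>. tsubst e (cenv \<phi> \<zeta>)) A" for e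
  proof (cases A)
    case (Atom X ts)
    then show ?thesis by (auto simp: cenv_def)
  next
    case (All2 \<chi> B)
    then show ?thesis
    proof (cases \<chi>)
      case (FO x)
      then show ?thesis using All2 quant[where B = B and \<chi> = \<chi>]
        by (simp add: Let_def IH hoas2_fo_inst cenv_def[of \<phi> "FO z" for z])
    next
      case (SO X)
      then show ?thesis using All2 quant[where B = B and \<chi> = \<chi>] decode[where \<phi> = \<phi>, OF bij]
        by (simp add: Let_def IH hoas2_so_inst_Sv cenv_def[of \<phi> "SO z" for z])
    qed
  next
    case (Ex2 \<chi> B)
    then show ?thesis
    proof (cases \<chi>)
      case (FO x)
      then show ?thesis using Ex2 quant[where B = B and \<chi> = \<chi>]
        by (simp add: Let_def IH hoas2_fo_inst cenv_def[of \<phi> "FO z" for z])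
    next
      case (SO X)
      then show ?thesis using Ex2 quant[where B = B and \<chi> = \<chi>] decode[where \<phi> = \<phi>, OF bij]
        by (simp add: Let_def IH hoas2_so_inst_Sv cenv_def[of \<phi> "SO z" for z])
    qed
  qed (auto simp: IH)
  then show ?case by (simp add: alpha_def hoas1_cod)
qed

lemma alpha_cod_fo_inst:
  "alpha (cod r (fo_inst x t A)) (cod (r(FO x := tsubst (\<lambda>z. r (FO z)) t)) A)"
  by (auto simp: alpha_def hoas1_cod hoas2_fo_inst intro: hoas2_cong)

text \<open>On a closed formula all environments agree. Thus the comprehension axioms, coded once by
  \<open>code \<phi>\<close>, are available under every \<open>r\<close>.\<close>

lemma alpha_code_closed:
  assumes "\<And>n. bij_betw (\<phi> n) {X. arity X = n} UNIV" "Free2 A = {}"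
  shows "alpha (code \<phi> A) (cod r A)"
proof -
  have "cod (cenv \<phi>) A = cod r A" using assms(2) by (intro cod_cong) simp
  then show ?thesis using alpha_code[OF assms(1), where A = A] by simp
qed

section \<open>Instantiating a second-order variable\<close>

definition Iff1 :: "'f fm1 \<Rightarrow> 'f fm1 \<Rightarrow> 'f fm1" where
  "Iff1 A B = And1 (Imp1 A B) (Imp1 B A)"

lemma is_fm1_Iff1 [simp]: "is_fm1 S (Iff1 A B) \<longleftrightarrow> is_fm1 S A \<and> is_fm1 S B"
  by (auto simp: Iff1_def)

lemma cod_Iff2: "cod r (Iff2 A B) = Iff1 (cod r A) (cod r B)"
  by (simp add: Iff1_def Iff2_def)

lemma nd1_IffI:
  assumes "nd1 S k (insert A \<Gamma>) B" "nd1 S k (insert B \<Gamma>) A" "is_fm1 S A" "is_fm1 S B"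
  shows "nd1 S k \<Gamma> (Iff1 A B)"
  using assms by (auto simp: Iff1_def intro: AndI1 ImpI1)

lemma nd1_IffD1: "nd1 S k \<Gamma> (Iff1 A B) \<Longrightarrow> nd1 S k \<Gamma> A \<Longrightarrow> nd1 S k \<Gamma> B"
  unfolding Iff1_def using AndE1l ImpE1 by blast

lemma nd1_IffD2: "nd1 S k \<Gamma> (Iff1 A B) \<Longrightarrow> nd1 S k \<Gamma> B \<Longrightarrow> nd1 S k \<Gamma> A"
  unfolding Iff1_def using AndE1r ImpE1 by blast

lemma nd1_Iff_is_fm1: "nd1 S k \<Gamma> (Iff1 A B) \<Longrightarrow> is_fm1 S A \<and> is_fm1 S B"
  using nd1_is_fm1 by fastforce

lemma nd1_Iff_refl: "is_fm1 S A \<Longrightarrow> nd1 S k \<Gamma> (Iff1 A A)"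
  by (intro nd1_IffI nd1_Assm_insert)

lemma nd1_insert: "nd1 S k \<Gamma> B \<Longrightarrow> nd1 S k (insert A \<Gamma>) B"
  by (rule Weak1) auto

lemma nd1_Iff_Imp:
  assumes "nd1 S k \<Gamma> (Iff1 A A')" "nd1 S k \<Gamma> (Iff1 B B')"
  shows "nd1 S k \<Gamma> (Iff1 (Imp1 A B) (Imp1 A' B'))"
proof -
  note fm = nd1_Iff_is_fm1[OF assms(1)] nd1_Iff_is_fm1[OF assms(2)]
  have "nd1 S k (insert (Imp1 A B) \<Gamma>) (Imp1 A' B')"
  proof (rule ImpI1)
    let ?\<Delta> = "insert A' (insert (Imp1 A B) \<Gamma>)"
    have "nd1 S k ?\<Delta> A" 
      using fm nd1_IffD2[OF nd1_insert[OF nd1_insert[OF assms(1)]] nd1_Assm_insert] by blast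
    moreover have "nd1 S k ?\<Delta> (Imp1 A B)" using fm by (auto intro: Assm1)
    ultimately have "nd1 S k ?\<Delta> B" using ImpE1 by blast
    then show "nd1 S k ?\<Delta> B'" by (rule nd1_IffD1[rotated]) (intro nd1_insert assms)
  qed (use fm in simp)
  moreover have "nd1 S k (insert (Imp1 A' B') \<Gamma>) (Imp1 A B)"
  proof (rule ImpI1)
    let ?\<Delta> = "insert A (insert (Imp1 A' B') \<Gamma>)"
    have "nd1 S k ?\<Delta> A'" 
      using fm nd1_IffD1[OF nd1_insert[OF nd1_insert[OF assms(1)]] nd1_Assm_insert] by blast
    moreover have "nd1 S k ?\<Delta> (Imp1 A' B')" using fm by (auto intro: Assm1)
    ultimately have "nd1 S k ?\<Delta> B'" using ImpE1 by blast
    then show "nd1 S k ?\<Delta> B" by (rule nd1_IffD2[rotated]) (intro nd1_insert assms)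
  qed (use fm in simp)
  ultimately show ?thesis using fm by (intro nd1_IffI) auto
qed

lemma nd1_Iff_And:
  assumes "nd1 S k \<Gamma> (Iff1 A A')" "nd1 S k \<Gamma> (Iff1 B B')"
  shows "nd1 S k \<Gamma> (Iff1 (And1 A B) (And1 A' B'))"
proof -
  note fm = nd1_Iff_is_fm1[OF assms(1)] nd1_Iff_is_fm1[OF assms(2)]
  have assm: "nd1 S k (insert (And1 C D) \<Gamma>) C" "nd1 S k (insert (And1 C D) \<Gamma>) D"
    if "is_fm1 S C" "is_fm1 S D" for C D
    using that AndE1l AndE1r nd1_Assm_insert[of S "And1 C D" k \<Gamma>] by auto
  have "nd1 S k (insert (And1 A B) \<Gamma>) (And1 A' B')"
    using fm nd1_IffD1[OF nd1_insert[OF assms(1)] assm(1)[of A B]]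
      nd1_IffD1[OF nd1_insert[OF assms(2)] assm(2)[of A B]] by (blast intro: AndI1)
  moreover have "nd1 S k (insert (And1 A' B') \<Gamma>) (And1 A B)"
    using fm nd1_IffD2[OF nd1_insert[OF assms(1)] assm(1)[of A' B']]
      nd1_IffD2[OF nd1_insert[OF assms(2)] assm(2)[of A' B']] by (blast intro: AndI1)
  ultimately show ?thesis using fm by (intro nd1_IffI) auto
qed

lemma nd1_Iff_Or:
  assumes "nd1 S k \<Gamma> (Iff1 A A')" "nd1 S k \<Gamma> (Iff1 B B')"
  shows "nd1 S k \<Gamma> (Iff1 (Or1 A B) (Or1 A' B'))"
proof -
  note fm = nd1_Iff_is_fm1[OF assms(1)] nd1_Iff_is_fm1[OF assms(2)]
  have or: "nd1 S k (insert (Or1 C D) \<Gamma>) (Or1 C' D')"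
    if "\<And>\<Delta>. \<Gamma> \<subseteq> \<Delta> \<Longrightarrow> nd1 S k (insert C \<Delta>) C'" "\<And>\<Delta>. \<Gamma> \<subseteq> \<Delta> \<Longrightarrow> nd1 S k (insert D \<Delta>) D'"
      "is_fm1 S C" "is_fm1 S C'" "is_fm1 S D" "is_fm1 S D'" for C C' D D'
  proof (rule OrE1)
    show "nd1 S k (insert (Or1 C D) \<Gamma>) (Or1 C D)" using that by (intro nd1_Assm_insert) simp
    show "nd1 S k (insert C (insert (Or1 C D) \<Gamma>)) (Or1 C' D')"
      by (intro OrI1l that(1)) (use that in auto)
    show "nd1 S k (insert D (insert (Or1 C D) \<Gamma>)) (Or1 C' D')"
      by (intro OrI1r that(2)) (use that in auto)
  qed
  have weak: "nd1 S k (insert C \<Delta>) F" if "\<Gamma> \<subseteq> \<Delta>" "nd1 S k \<Gamma> F" for C F \<Delta>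
    using that Weak1[of S k \<Gamma> F "insert C \<Delta>"] by auto
  show ?thesis
  proof (rule nd1_IffI)
    show "nd1 S k (insert (Or1 A B) \<Gamma>) (Or1 A' B')"
      using fm by (intro or) (auto intro: nd1_IffD1[OF weak[OF _ assms(1)]]
        nd1_IffD1[OF weak[OF _ assms(2)]] nd1_Assm_insert)
    show "nd1 S k (insert (Or1 A' B') \<Gamma>) (Or1 A B)"
      using fm by (intro or) (auto intro: nd1_IffD2[OF weak[OF _ assms(1)]]
        nd1_IffD2[OF weak[OF _ assms(2)]] nd1_Assm_insert)
  qed (use fm in auto)
qed

text \<open>The two sides may have different bound variables and environments. A common
  \<open>y\<close>, new for both and for the context, makes the bodies comparable and is the
  eigenvariable in both directions.\<close>

lemma cod_Iff_All:
  assumes "nd1 S k \<Gamma> (Iff1 (cod (r(\<chi> := Var y)) A) (cod (r'(\<chi>' := Var y)) A'))"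
    and "\<And>\<zeta>. is_trm S (r \<zeta>)" "\<And>\<zeta>. is_trm S (r' \<zeta>)"
    and "y \<notin> \<Union>(Free1 ` \<Gamma>)" "y \<notin> (\<Union>\<zeta>\<in>Free2 A. vars (r \<zeta>))" "y \<notin> (\<Union>\<zeta>\<in>Free2 A'. vars (r' \<zeta>))"
  shows "nd1 S k \<Gamma> (Iff1 (cod r (All2 \<chi> A)) (cod r' (All2 \<chi>' A')))"
proof (rule nd1_IffI)
  have fm: "is_fm2 S A" "is_fm2 S A'"
    using nd1_Iff_is_fm1[OF assms(1)] assms(2,3) by (auto simp: is_fm1_cod)
  show fm': "is_fm1 S (cod r (All2 \<chi> A))" "is_fm1 S (cod r' (All2 \<chi>' A'))"
    using fm assms(2,3) by (simp_all only: is_fm1_cod is_fm2.simps)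
  have free: "y \<notin> Free1 (cod r (All2 \<chi> A))" "y \<notin> Free1 (cod r' (All2 \<chi>' A'))"
    using assms(5,6) unfolding Free1_cod by auto
  show "nd1 S k (insert (cod r (All2 \<chi> A)) \<Gamma>) (cod r' (All2 \<chi>' A'))"
  proof (rule cod_AllI[OF nd1_IffD1[OF nd1_insert[OF assms(1)]]])
    show "nd1 S k (insert (cod r (All2 \<chi> A)) \<Gamma>) (cod (r(\<chi> := Var y)) A)"
      using fm' by (intro cod_AllE nd1_Assm_insert) simp_all
  qed (use assms free in auto)
  show "nd1 S k (insert (cod r' (All2 \<chi>' A')) \<Gamma>) (cod r (All2 \<chi> A))"
  proof (rule cod_AllI[OF nd1_IffD2[OF nd1_insert[OF assms(1)]]])
    show "nd1 S k (insert (cod r' (All2 \<chi>' A')) \<Gamma>) (cod (r'(\<chi>' := Var y)) A')"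
      using fm' by (intro cod_AllE nd1_Assm_insert) simp_all
  qed (use assms free in auto)
qed

lemma cod_Iff_Ex:
  assumes "nd1 S k \<Gamma> (Iff1 (cod (r(\<chi> := Var y)) A) (cod (r'(\<chi>' := Var y)) A'))"
    and "\<And>\<zeta>. is_trm S (r \<zeta>)" "\<And>\<zeta>. is_trm S (r' \<zeta>)"
    and "y \<notin> \<Union>(Free1 ` \<Gamma>)" "y \<notin> (\<Union>\<zeta>\<in>Free2 A. vars (r \<zeta>))" "y \<notin> (\<Union>\<zeta>\<in>Free2 A'. vars (r' \<zeta>))"
  shows "nd1 S k \<Gamma> (Iff1 (cod r (Ex2 \<chi> A)) (cod r' (Ex2 \<chi>' A')))"
proof (rule nd1_IffI)
  have fm: "is_fm2 S A" "is_fm2 S A'"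
    using nd1_Iff_is_fm1[OF assms(1)] assms(2,3) by (auto simp: is_fm1_cod)
  show fm': "is_fm1 S (cod r (Ex2 \<chi> A))" "is_fm1 S (cod r' (Ex2 \<chi>' A'))"
    using fm assms(2,3) by (simp_all only: is_fm1_cod is_fm2.simps)
  have fm1: "is_fm1 S (cod (r(\<chi> := Var y)) A)" "is_fm1 S (cod (r'(\<chi>' := Var y)) A')"
    using nd1_Iff_is_fm1[OF assms(1)] by auto
  have free: "y \<notin> Free1 (cod r (Ex2 \<chi> A))" "y \<notin> Free1 (cod r' (Ex2 \<chi>' A'))"
    using assms(5,6) unfolding Free1_cod by auto
  show "nd1 S k (insert (cod r (Ex2 \<chi> A)) \<Gamma>) (cod r' (Ex2 \<chi>' A'))"
  proof (rule cod_ExE[OF nd1_Assm_insert[OF fm'(1)]])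
    show "nd1 S k (insert (cod (r(\<chi> := Var y)) A) (insert (cod r (Ex2 \<chi> A)) \<Gamma>)) (cod r' (Ex2 \<chi>' A'))"
      by (rule cod_ExI[OF nd1_IffD1[OF nd1_insert[OF nd1_insert[OF assms(1)]]]])
        (use fm fm1 assms(3) in \<open>auto intro: nd1_Assm_insert\<close>)
  qed (use assms free in auto)
  show "nd1 S k (insert (cod r' (Ex2 \<chi>' A')) \<Gamma>) (cod r (Ex2 \<chi> A))"
  proof (rule cod_ExE[OF nd1_Assm_insert[OF fm'(2)]])
    show "nd1 S k (insert (cod (r'(\<chi>' := Var y)) A') (insert (cod r' (Ex2 \<chi>' A')) \<Gamma>)) (cod r (Ex2 \<chi> A))"
      by (rule cod_ExI[OF nd1_IffD2[OF nd1_insert[OF nd1_insert[OF assms(1)]]]])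
        (use fm fm1 assms(2) in \<open>auto intro: nd1_Assm_insert\<close>)
  qed (use assms free in auto)
qed

section \<open>Replacing a second-order variable by an abstraction\<close>

definition upds :: "(lvar \<Rightarrow> 'f trm) \<Rightarrow> var list \<Rightarrow> 'f trm list \<Rightarrow> lvar \<Rightarrow> 'f trm" where
  "upds r xs ts \<zeta> = (case \<zeta> of
      FO z \<Rightarrow> (case map_of (zip xs ts) z of Some t \<Rightarrow> t | None \<Rightarrow> r \<zeta>)
    | SO Z \<Rightarrow> r \<zeta>)"

text \<open>The arguments \<open>ts\<close> are already evaluated, so those of an abstraction enter
  its environment directly, in place of the substitution performed by
  \<open>inst_app\<close>.\<close>

primrec cod_inst :: "(lvar \<Rightarrow> 'f trm) \<Rightarrow> 'f inst \<Rightarrow> 'f trm list \<Rightarrow> 'f fm1" where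
  "cod_inst r (Sv Y) ts = Ap (arity Y) (r (SO Y) # ts)"
| "cod_inst r (Lam xs G) ts = cod (upds r xs ts) G"

lemma alpha_cod_inst_app:
  "alpha (cod r (inst_app T ts)) (cod_inst r T (map (tsubst (\<lambda>x. r (FO x))) ts))"
proof (cases T)
  case (Sv Y)
  then show ?thesis by (simp add: alpha_def)
next
  case (Lam xs G)
  then show ?thesis
    by (auto simp: alpha_def hoas1_cod hoas2_fsubst upds_def zip_map2 map_of_map
        intro!: hoas2_cong split: lvar.split option.split)
qed

text \<open>Besides not occurring free in \<open>G\<close>, \<open>\<xi>\<close> may be one of the
  parameters \<open>xs\<close>. Then its value comes from \<open>ts\<close>, which must be as long
  as \<open>xs\<close> so that \<open>zip\<close> drops no parameter.\<close>

lemma cod_inst_upd_fresh: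
  assumes "\<xi> \<notin> Free_inst T" "\<And>xs G. T = Lam xs G \<Longrightarrow> length xs = length ts"
  shows "cod_inst (r(\<xi> := d)) T ts = cod_inst r T ts"
proof (cases T)
  case (Sv Y)
  then show ?thesis using assms by auto
next
  case (Lam xs G)
  have "upds (r(\<xi> := d)) xs ts \<zeta> = upds r xs ts \<zeta>" if free: "\<zeta> \<in> Free2 G" for \<zeta>
  proof (cases "\<zeta> = \<xi>")
    case True
    then obtain x where x: "\<zeta> = FO x" "x \<in> set xs" using assms(1) free True Lam by auto
    then obtain t where "map_of (zip xs ts) x = Some t"
      using assms(2)[OF Lam] by (metis map_of_zip_is_Some)
    then show ?thesis using x by (simp add: upds_def)
  next
    case False
    then show ?thesis by (simp add: upds_def split: lvar.split option.split)
  qed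
  then show ?thesis using Lam by (simp cong: cod_cong)
qed

text \<open>Replacement of equivalents, by induction on \<open>A\<close>. The equivalence is assumed
  for all \<open>ts\<close> because the arguments of an atom may involve the variables chosen at the
  quantifiers above it. \<open>\<Gamma>\<close> may be infinite; that its free variables are
  finitely many provides a new \<open>y\<close> at each quantifier.\<close>

lemma cod_subst2:
  assumes "finite (\<Union>(Free1 ` \<Gamma>))" "is_fm2 S A"
    and "\<And>\<zeta>. is_trm S (r \<zeta>)" "\<And>\<zeta>. is_trm S (r' \<zeta>)"
    and "\<And>z. FO z \<in> Free2 A \<Longrightarrow> r' (FO z) = tsubst (\<lambda>x. r (FO x)) (\<sigma> z)"
    and "\<And>Z ts. SO Z \<in> Free2 A \<Longrightarrow> list_all (is_trm S) ts \<Longrightarrow> length ts = arity Z \<Longrightarrow>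
      nd1 S k \<Gamma> (Iff1 (cod_inst r (\<theta> Z) ts) (Ap (arity Z) (r' (SO Z) # ts)))"
    and "\<And>Z xs G. \<theta> Z = Lam xs G \<Longrightarrow> length xs = arity Z"
  shows "nd1 S k \<Gamma> (Iff1 (cod r (subst2 \<sigma> \<theta> A)) (cod r' A))"
  using assms(2-)
proof (induction A arbitrary: r r' \<sigma> \<theta>)
  case Bot2
  then show ?case by (simp add: nd1_Iff_refl)
next
  case (Atom X ts)
  let ?ts = "map (tsubst (\<lambda>x. r' (FO x))) ts"
  have eq: "map (tsubst (\<lambda>x. r (FO x))) (map (tsubst \<sigma>) ts) = ?ts"
    using Atom.prems(4)[symmetric] by (auto intro!: tsubst_cong)
  have al: "alpha (cod r (subst2 \<sigma> \<theta> (Atom X ts))) (cod_inst r (\<theta> X) ?ts)"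
    using alpha_cod_inst_app[of r "\<theta> X" "map (tsubst \<sigma>) ts"] unfolding eq by simp
  have "list_all (is_trm S) ?ts" "length ?ts = arity X"
    using Atom.prems(1,3) by (auto simp: list_all_iff is_trm_tsubst)
  then have "nd1 S k \<Gamma> (Iff1 (cod_inst r (\<theta> X) ?ts) (cod r' (Atom X ts)))"
    using Atom.prems(5)[of X ?ts] by simp
  moreover have "alpha (Iff1 (cod_inst r (\<theta> X) ?ts) (cod r' (Atom X ts)))
      (Iff1 (cod r (subst2 \<sigma> \<theta> (Atom X ts))) (cod r' (Atom X ts)))"
    using al by (simp add: alpha_def Iff1_def)
  ultimately show ?case by (rule alpha_nd1)
next
  case (Imp2 A B)
  show ?case
    unfolding subst2.simps cod.simps
    by (rule nd1_Iff_Imp; rule Imp2.IH) (use Imp2.prems in simp_all)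
next
  case (And2 A B)
  show ?case
    unfolding subst2.simps cod.simps
    by (rule nd1_Iff_And; rule And2.IH) (use And2.prems in simp_all)
next
  case (Or2 A B)
  show ?case
    unfolding subst2.simps cod.simps
    by (rule nd1_Iff_Or; rule Or2.IH) (use Or2.prems in simp_all)
next
  case (All2 \<chi> A)
  obtain \<chi>' \<sigma>' \<theta>' where b: "subst2 \<sigma> \<theta> (All2 \<chi> A) = All2 \<chi>' (subst2 \<sigma>' \<theta>' A)"
    "\<And>(r :: lvar \<Rightarrow> 'a trm) d z. FO z \<in> Free2 A \<Longrightarrow> tsubst (\<lambda>x. (r(\<chi>' := d)) (FO x)) (\<sigma>' z)
      = (if FO z = \<chi> then d else tsubst (\<lambda>x. r (FO x)) (\<sigma> z))"
    "\<And>Z. SO Z = \<chi> \<Longrightarrow> \<exists>Y. \<chi>' = SO Y \<and> arity Y = arity Z \<and> \<theta>' Z = Sv Y"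
    "\<And>Z. SO Z \<in> Free2 A \<Longrightarrow> SO Z \<noteq> \<chi> \<Longrightarrow> \<theta>' Z = \<theta> Z \<and> \<chi>' \<notin> Free_inst (\<theta> Z)"
    "\<And>Z xs G. \<theta>' Z = Lam xs G \<Longrightarrow> \<theta> Z = Lam xs G"
    by (rule subst2_binder[of \<sigma> \<theta> \<chi> A]) blast
  define A' where "A' = subst2 \<sigma>' \<theta>' A"
  have "finite (\<Union>(Free1 ` \<Gamma>) \<union> (\<Union>\<zeta>\<in>Free2 A'. vars (r \<zeta>)) \<union> (\<Union>\<zeta>\<in>Free2 A. vars (r' \<zeta>)))"
    using assms(1) by simp
  then obtain y where y: "y \<notin> \<Union>(Free1 ` \<Gamma>)" "y \<notin> (\<Union>\<zeta>\<in>Free2 A'. vars (r \<zeta>))"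
    "y \<notin> (\<Union>\<zeta>\<in>Free2 A. vars (r' \<zeta>))"
    by (auto dest!: ex_new_if_finite[OF infinite_UNIV_nat] simp only: Un_iff)
  have "nd1 S k \<Gamma> (Iff1 (cod (r(\<chi>' := Var y)) A') (cod (r'(\<chi> := Var y)) A))"
    unfolding A'_def
  proof (rule All2.IH)
    show "(r'(\<chi> := Var y)) (FO z) = tsubst (\<lambda>x. (r(\<chi>' := Var y)) (FO x)) (\<sigma>' z)"
      if "FO z \<in> Free2 A" for z
      using that All2.prems(4)[of z] by (simp add: b(2) del: fun_upd_apply) simp
    show "nd1 S k \<Gamma> (Iff1 (cod_inst (r(\<chi>' := Var y)) (\<theta>' Z) ts)
        (Ap (arity Z) ((r'(\<chi> := Var y)) (SO Z) # ts)))"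
      if Z: "SO Z \<in> Free2 A" and ts: "list_all (is_trm S) ts" "length ts = arity Z" for Z ts
    proof (cases "SO Z = \<chi>")
      case True
      \<comment> \<open>A second-order variable bound here is merely renamed, and both environments
        give it the value \<open>Var y\<close>, so the two atoms coincide.\<close>
      then show ?thesis using b(3)[OF True] ts by (auto intro!: nd1_Iff_refl)
    next
      case False
      \<comment> \<open>Avoidance of capture enters here: \<open>\<chi>'\<close> is not free in
        \<open>\<theta> Z\<close>, so its new value does not reach the instance.\<close>
      have "cod_inst (r(\<chi>' := Var y)) (\<theta>' Z) ts = cod_inst r (\<theta> Z) ts"
        using b(4)[OF Z False] cod_inst_upd_fresh[of \<chi>' "\<theta> Z" ts r] All2.prems(6)[of Z] ts(2)
        by fastforce
      then show ?thesis using False All2.prems(5)[OF _ ts] Z by simp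
    qed
    show "length xs = arity Z" if "\<theta>' Z = Lam xs G" for Z xs G
      using that b(5) All2.prems(6) by blast
  qed (use All2.prems(1-3) in auto)
  then show ?case
    unfolding b(1) A'_def[symmetric] by (rule cod_Iff_All) (use y All2.prems(2,3) in auto)
next
  case (Ex2 \<chi> A)
  obtain \<chi>' \<sigma>' \<theta>' where b: "subst2 \<sigma> \<theta> (Ex2 \<chi> A) = Ex2 \<chi>' (subst2 \<sigma>' \<theta>' A)"
    "\<And>(r :: lvar \<Rightarrow> 'a trm) d z. FO z \<in> Free2 A \<Longrightarrow> tsubst (\<lambda>x. (r(\<chi>' := d)) (FO x)) (\<sigma>' z)
      = (if FO z = \<chi> then d else tsubst (\<lambda>x. r (FO x)) (\<sigma> z))"
    "\<And>Z. SO Z = \<chi> \<Longrightarrow> \<exists>Y. \<chi>' = SO Y \<and> arity Y = arity Z \<and> \<theta>' Z = Sv Y"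
    "\<And>Z. SO Z \<in> Free2 A \<Longrightarrow> SO Z \<noteq> \<chi> \<Longrightarrow> \<theta>' Z = \<theta> Z \<and> \<chi>' \<notin> Free_inst (\<theta> Z)"
    "\<And>Z xs G. \<theta>' Z = Lam xs G \<Longrightarrow> \<theta> Z = Lam xs G"
    by (rule subst2_binder[of \<sigma> \<theta> \<chi> A]) blast
  define A' where "A' = subst2 \<sigma>' \<theta>' A"
  have "finite (\<Union>(Free1 ` \<Gamma>) \<union> (\<Union>\<zeta>\<in>Free2 A'. vars (r \<zeta>)) \<union> (\<Union>\<zeta>\<in>Free2 A. vars (r' \<zeta>)))"
    using assms(1) by simp
  then obtain y where y: "y \<notin> \<Union>(Free1 ` \<Gamma>)" "y \<notin> (\<Union>\<zeta>\<in>Free2 A'. vars (r \<zeta>))"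
    "y \<notin> (\<Union>\<zeta>\<in>Free2 A. vars (r' \<zeta>))"
    by (auto dest!: ex_new_if_finite[OF infinite_UNIV_nat] simp only: Un_iff)
  have "nd1 S k \<Gamma> (Iff1 (cod (r(\<chi>' := Var y)) A') (cod (r'(\<chi> := Var y)) A))"
    unfolding A'_def
  proof (rule Ex2.IH)
    show "(r'(\<chi> := Var y)) (FO z) = tsubst (\<lambda>x. (r(\<chi>' := Var y)) (FO x)) (\<sigma>' z)"
      if "FO z \<in> Free2 A" for z
      using that Ex2.prems(4)[of z] by (simp add: b(2) del: fun_upd_apply) simp
    show "nd1 S k \<Gamma> (Iff1 (cod_inst (r(\<chi>' := Var y)) (\<theta>' Z) ts)
        (Ap (arity Z) ((r'(\<chi> := Var y)) (SO Z) # ts)))"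
      if Z: "SO Z \<in> Free2 A" and ts: "list_all (is_trm S) ts" "length ts = arity Z" for Z ts
    proof (cases "SO Z = \<chi>")
      case True
      then show ?thesis using b(3)[OF True] ts by (auto intro!: nd1_Iff_refl)
    next
      case False
      have "cod_inst (r(\<chi>' := Var y)) (\<theta>' Z) ts = cod_inst r (\<theta> Z) ts"
        using b(4)[OF Z False] cod_inst_upd_fresh[of \<chi>' "\<theta> Z" ts r] Ex2.prems(6)[of Z] ts(2)
        by fastforce
      then show ?thesis using False Ex2.prems(5)[OF _ ts] Z by simp
    qed
    show "length xs = arity Z" if "\<theta>' Z = Lam xs G" for Z xs G
      using that b(5) Ex2.prems(6) by blast
  qed (use Ex2.prems(1-3) in auto)
  then show ?case
    unfolding b(1) A'_def[symmetric] by (rule cod_Iff_Ex) (use y Ex2.prems(2,3) in auto)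
qed

section \<open>Coded comprehension axioms\<close>

lemma is_fm2_Alls2 [simp]: "is_fm2 S (Alls2 \<chi>s A) = is_fm2 S A"
  by (induction \<chi>s) (auto simp: Alls2_def)

lemma Free2_Alls2 [simp]: "Free2 (Alls2 \<chi>s A) = Free2 A - set \<chi>s"
  by (induction \<chi>s) (auto simp: Alls2_def)

text \<open>Each quantifier is instantiated by the value that \<open>r\<close> already gives to its
  variable, so the environment stays \<open>r\<close>.\<close>

lemma cod_AllsE_same:
  assumes "\<And>\<zeta>. is_trm S (r \<zeta>)" "nd1 S k \<Gamma> (cod r (Alls2 \<chi>s A))"
  shows "nd1 S k \<Gamma> (cod r A)"
  using assms(2)
proof (induction \<chi>s)
  case (Cons \<chi> \<chi>s)
  then have "nd1 S k \<Gamma> (cod (r(\<chi> := r \<chi>)) (Alls2 \<chi>s A))"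
    using assms(1) by (intro cod_AllE) (simp_all add: Alls2_def)
  then show ?case using Cons.IH by simp
qed (simp add: Alls2_def)

text \<open>With \<open>x\<close> absent from \<open>xs\<close>, no later parameter overrides its
  value, so updating one by one agrees with the simultaneous update.\<close>

lemma upds_Cons: "x \<notin> set xs \<Longrightarrow> upds (r(FO x := t)) xs ts = upds r (x # xs) (t # ts)"
proof
  fix \<zeta> assume "x \<notin> set xs"
  then have "map_of (zip xs ts) x = None"
    by (auto simp: map_of_eq_None_iff dest: set_zip_leftD)
  then show "upds (r(FO x := t)) xs ts \<zeta> = upds r (x # xs) (t # ts) \<zeta>"
    by (auto simp: upds_def split: lvar.split option.split)
qed

lemma cod_AllsE:
  assumes "nd1 S k \<Gamma> (cod r (Alls2 (map FO xs) A))" "list_all (is_trm S) ts"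
    "length ts = length xs" "distinct xs"
  shows "nd1 S k \<Gamma> (cod (upds r xs ts) A)"
  using assms
proof (induction xs arbitrary: r ts)
  case Nil
  have "upds r [] ts = r" by (auto simp: upds_def fun_eq_iff split: lvar.split)
  then show ?case using Nil by (simp add: Alls2_def)
next
  case (Cons x xs)
  then obtain t us where ts: "ts = t # us" by (cases ts) auto
  have "nd1 S k \<Gamma> (cod (r(FO x := t)) (Alls2 (map FO xs) A))"
    using Cons.prems ts by (intro cod_AllE) (simp_all add: Alls2_def)
  then have "nd1 S k \<Gamma> (cod (upds (r(FO x := t)) xs us) A)"
    using Cons.prems ts by (intro Cons.IH) (auto simp del: fun_upd_apply)
  then show ?case using Cons.prems ts by (simp add: upds_Cons)
qed

lemma map_upds: "distinct xs \<Longrightarrow> length ts = length xs \<Longrightarrow> map (\<lambda>x. upds r xs ts (FO x)) xs = ts"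
  by (auto simp: list_eq_iff_nth_eq upds_def map_of_zip_nth)

lemma Free1_SC1:
  assumes "\<And>n. bij_betw (\<phi> n) {X. arity X = n} UNIV" "F \<in> SC1 S \<phi>"
  shows "Free1 F = {}"
proof -
  obtain A where A: "F = code \<phi> A" "Free2 A = {}" using assms(2) by (auto simp: SC1_def SC2_def)
  then have "Free1 F = Free1 (cod (cenv \<phi>) A)" by (simp add: alpha_Free1[OF alpha_code[OF assms(1)]])
  then show ?thesis using A(2) by (simp add: Free1_cod)
qed

text \<open>The comprehension axioms are closed, so only the finitely many formulas from
  \<open>\<Gamma>\<close> contribute.\<close>

lemma finite_Free1_context:
  assumes "\<And>n. bij_betw (\<phi> n) {X. arity X = n} UNIV" "finite \<Gamma>"
  shows "finite (\<Union>(Free1 ` (cod r ` \<Gamma> \<union> SC1 S \<phi>)))"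
proof -
  have "\<Union>(Free1 ` (cod r ` \<Gamma> \<union> SC1 S \<phi>)) = \<Union>(Free1 ` cod r ` \<Gamma>)"
    using Free1_SC1[OF assms(1)] by auto
  then show ?thesis using assms(2) by simp
qed

lemma SC1_cod:
  assumes "\<And>n. bij_betw (\<phi> n) {X. arity X = n} UNIV" "\<And>\<zeta>. is_trm S (r \<zeta>)"
    and "F \<in> SC2 S" "SC1 S \<phi> \<subseteq> \<Gamma>"
  shows "nd1 S k \<Gamma> (cod r F)"
proof -
  have F: "is_fm2 S F" "Free2 F = {}" using assms(3) by (auto simp: SC2_def)
  have al: "alpha (code \<phi> F) (cod r F)" by (rule alpha_code_closed[OF assms(1) F(2)])
  then have "is_fm1 S (code \<phi> F)" using F(1) assms(2) by (simp add: alpha_is_fm1 is_fm1_cod)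
  moreover have "code \<phi> F \<in> \<Gamma>" using assms(3,4) by (auto simp: SC1_def)
  ultimately show ?thesis using al by (intro alpha_nd1[OF Assm1])
qed

text \<open>The witness \<open>y\<close> is an eigenvariable and must not be free in the conclusion;
  hence the form with a goal \<open>C\<close>, to be derived from any extension
  \<open>\<Delta>\<close> in which \<open>y\<close> represents the abstraction.\<close>

lemma comprehension:
  assumes "\<And>n. bij_betw (\<phi> n) {X. arity X = n} UNIV" "SC1 S \<phi> \<subseteq> \<Gamma>" "finite (\<Union>(Free1 ` \<Gamma>))"
    and r: "\<And>\<zeta>. is_trm S (r \<zeta>)" and fm: "is_fm2 S A" "is_fm2 S G"
    and xs: "distinct xs" "length xs = arity X"
    and step: "\<And>y \<Delta>. \<Gamma> \<subseteq> \<Delta> \<Longrightarrow>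
      nd1 S k \<Delta> (Iff1 (cod r (so_inst X (Lam xs G) A)) (cod (r(SO X := Var y)) A)) \<Longrightarrow> nd1 S k \<Delta> C"
  shows "nd1 S k \<Gamma> C"
proof -
  \<comment> \<open>\<open>X\<close> may be free in \<open>G\<close>, which the comprehension axiom
    forbids for its own variable; so another one of the same arity is taken.\<close>
  define X' where "X' = new_so (arity X) (Free2 G)"
  have X': "arity X' = arity X" "SO X' \<notin> Free2 G"
    using new_so_fresh[of "Free2 G"] by (auto simp: X'_def)
  \<comment> \<open>Quantifying over all free variables of \<open>G\<close>, including those among
    \<open>xs\<close>, makes the axiom closed.\<close>
  obtain \<chi>s where \<chi>s: "set \<chi>s = Free2 G" using finite_list[OF finite_Free2] by blast
  define B where "B = Alls2 (map FO xs) (Iff2 G (Atom X' (map Var xs)))"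
  have fmB: "is_fm2 S B" using fm xs X' by (simp add: B_def Iff2_def list_all_iff)
  have "Alls2 \<chi>s (Ex2 (SO X') B) \<in> SC2 S"
    unfolding SC2_def B_def
    by (rule CollectI, rule exI[of _ \<chi>s], rule exI[of _ X'], rule exI[of _ xs], rule exI[of _ G])
      (use fm xs X' \<chi>s in \<open>auto simp: Iff2_def list_all_iff\<close>)
  then have ex: "nd1 S k \<Gamma> (cod r (Ex2 (SO X') B))"
    by (rule cod_AllsE_same[OF r SC1_cod[OF assms(1) r _ assms(2)]])
  have "finite (\<Union>(Free1 ` \<Gamma>) \<union> Free1 C \<union> (\<Union>\<zeta>\<in>Free2 B - {SO X'}. vars (r \<zeta>)))"
    using assms(3) by simp
  then obtain y where y: "y \<notin> \<Union>(Free1 ` \<Gamma>) \<union> Free1 C" "y \<notin> (\<Union>\<zeta>\<in>Free2 B - {SO X'}. vars (r \<zeta>))"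
    by (auto dest!: ex_new_if_finite[OF infinite_UNIV_nat] simp only: Un_iff)
  let ?r = "r(SO X' := Var y)"
  define \<Delta> where "\<Delta> = insert (cod ?r B) \<Gamma>"
  have r': "is_trm S (?r \<zeta>)" for \<zeta> using r by simp
  have iff: "nd1 S k \<Delta> (Iff1 (cod_inst r (Lam xs G) ts) (Ap (arity X) (Var y # ts)))"
    if ts: "list_all (is_trm S) ts" "length ts = arity X" for ts
  proof -
    have "nd1 S k \<Delta> (cod ?r (Alls2 (map FO xs) (Iff2 G (Atom X' (map Var xs)))))"
      unfolding \<Delta>_def B_def[symmetric] using fmB r' by (intro nd1_Assm_insert) (simp only: is_fm1_cod)
    then have "nd1 S k \<Delta> (cod (upds ?r xs ts) (Iff2 G (Atom X' (map Var xs))))"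
      using ts xs by (intro cod_AllsE) auto
    \<comment> \<open>\<open>X'\<close> is not free in \<open>G\<close>, so the value
      \<open>Var y\<close> is invisible there.\<close>
    moreover have "cod (upds ?r xs ts) G = cod (upds r xs ts) G"
      using X'(2) by (intro cod_cong) (auto simp: upds_def split: lvar.split option.split)
    moreover have "cod (upds ?r xs ts) (Atom X' (map Var xs)) = Ap (arity X) (Var y # ts)"
      using map_upds[of xs ts ?r] ts xs X'(1) by (simp add: comp_def) (simp add: upds_def)
    ultimately show ?thesis by (simp only: cod_Iff2 cod_inst.simps)
  qed
  have "nd1 S k \<Delta> (Iff1 (cod r (so_inst X (Lam xs G) A)) (cod (r(SO X := Var y)) A))"
    unfolding so_inst_def
  proof (rule cod_subst2)
    show "finite (\<Union>(Free1 ` \<Delta>))" using assms(3) by (simp add: \<Delta>_def)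
    show "nd1 S k \<Delta> (Iff1 (cod_inst r ((Sv(X := Lam xs G)) Z) ts)
        (Ap (arity Z) ((r(SO X := Var y)) (SO Z) # ts)))"
      if "list_all (is_trm S) ts" "length ts = arity Z" for Z ts
      using that iff r by (auto intro!: nd1_Iff_refl)
    show "length ys = arity Z" if "(Sv(X := Lam xs G)) Z = Lam ys H" for Z ys H
      using that xs by (simp split: if_splits)
  qed (use r fm in auto)
  then have "nd1 S k \<Delta> C" by (intro step) (auto simp: \<Delta>_def)
  then show ?thesis unfolding \<Delta>_def by (rule cod_ExE[OF ex _ y])
qed

section \<open>Translating derivations\<close>

text \<open>A coded infinite context may use up all first-order variables and leave no
  eigenvariable, so a derivation is first cut down to the hypotheses it uses. Those discharged by a
  rule are removed, and weakening restores them where the rule needs them.\<close>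

lemma nd2_finite:
  assumes "nd2 S k \<Gamma> A"
  shows "\<exists>\<Delta>\<subseteq>\<Gamma>. finite \<Delta> \<and> nd2 S k \<Delta> A"
  using assms
proof (induction rule: nd2.induct)
  case (Assm2 A \<Gamma>)
  then show ?case by (intro exI[of _ "{A}"]) (auto intro: nd2.Assm2)
next
  case (Weak2 \<Gamma> A \<Delta>)
  then show ?case by (meson subset_trans)
next
  case (BotE2 \<Gamma> A)
  then show ?case by (meson nd2.BotE2)
next
  case (RAA2 A \<Gamma>)
  then obtain \<Delta> where *: "\<Delta> \<subseteq> insert (Imp2 A Bot2) \<Gamma>" "finite \<Delta>" "nd2 S k \<Delta> Bot2" by blast
  let ?\<Delta> = "\<Delta> - {Imp2 A Bot2}"
  have "nd2 S k (insert (Imp2 A Bot2) ?\<Delta>) Bot2" by (rule nd2.Weak2[OF *(3)]) auto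
  then have "nd2 S k ?\<Delta> A" by (rule nd2.RAA2[OF RAA2.hyps(1) _ RAA2.hyps(3)])
  then show ?case using * by (intro exI[of _ ?\<Delta>]) auto
next
  case (ImpI2 A \<Gamma> B)
  then obtain \<Delta> where *: "\<Delta> \<subseteq> insert A \<Gamma>" "finite \<Delta>" "nd2 S k \<Delta> B" by blast
  have "nd2 S k (insert A (\<Delta> - {A})) B" by (rule nd2.Weak2[OF *(3)]) auto
  then have "nd2 S k (\<Delta> - {A}) (Imp2 A B)" by (rule nd2.ImpI2[OF _ ImpI2.hyps(2)])
  then show ?case using * by (intro exI[of _ "\<Delta> - {A}"]) auto
next
  case (ImpE2 \<Gamma> A B)
  then obtain \<Delta> \<Delta>' where *: "\<Delta> \<subseteq> \<Gamma>" "finite \<Delta>" "nd2 S k \<Delta> (Imp2 A B)"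
    "\<Delta>' \<subseteq> \<Gamma>" "finite \<Delta>'" "nd2 S k \<Delta>' A" by blast
  have "nd2 S k (\<Delta> \<union> \<Delta>') B"
    by (rule nd2.ImpE2[OF nd2.Weak2[OF *(3)] nd2.Weak2[OF *(6)]]) auto
  then show ?case using * by (intro exI[of _ "\<Delta> \<union> \<Delta>'"]) auto
next
  case (AndI2 \<Gamma> A B)
  then obtain \<Delta> \<Delta>' where *: "\<Delta> \<subseteq> \<Gamma>" "finite \<Delta>" "nd2 S k \<Delta> A"
    "\<Delta>' \<subseteq> \<Gamma>" "finite \<Delta>'" "nd2 S k \<Delta>' B" by blast
  have "nd2 S k (\<Delta> \<union> \<Delta>') (And2 A B)"
    by (rule nd2.AndI2[OF nd2.Weak2[OF *(3)] nd2.Weak2[OF *(6)]]) auto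
  then show ?case using * by (intro exI[of _ "\<Delta> \<union> \<Delta>'"]) auto
next
  case (AndE2l \<Gamma> A B)
  then show ?case by (meson nd2.AndE2l)
next
  case (AndE2r \<Gamma> A B)
  then show ?case by (meson nd2.AndE2r)
next
  case (OrI2l \<Gamma> A B)
  then show ?case by (meson nd2.OrI2l)
next
  case (OrI2r \<Gamma> B A)
  then show ?case by (meson nd2.OrI2r)
next
  case (OrE2 \<Gamma> A B C)
  then obtain \<Delta> \<Delta>1 \<Delta>2 where *: "\<Delta> \<subseteq> \<Gamma>" "finite \<Delta>" "nd2 S k \<Delta> (Or2 A B)"
    "\<Delta>1 \<subseteq> insert A \<Gamma>" "finite \<Delta>1" "nd2 S k \<Delta>1 C"
    "\<Delta>2 \<subseteq> insert B \<Gamma>" "finite \<Delta>2" "nd2 S k \<Delta>2 C" by blast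
  let ?\<Delta> = "\<Delta> \<union> (\<Delta>1 - {A}) \<union> (\<Delta>2 - {B})"
  have "nd2 S k ?\<Delta> C"
    by (rule nd2.OrE2[OF nd2.Weak2[OF *(3)] nd2.Weak2[OF *(6)] nd2.Weak2[OF *(9)]]) auto
  then show ?case using * by (intro exI[of _ ?\<Delta>]) auto
next
  case (AllI2 \<Gamma> A \<chi>)
  then obtain \<Delta> where *: "\<Delta> \<subseteq> \<Gamma>" "finite \<Delta>" "nd2 S k \<Delta> A" by blast
  have "nd2 S k \<Delta> (All2 \<chi> A)" by (rule nd2.AllI2[OF *(3)]) (use AllI2.hyps * in auto)
  then show ?case using * by blast
next
  case (AllE2_fo \<Gamma> x A t)
  then show ?case by (meson nd2.AllE2_fo)
next
  case (AllE2_so \<Gamma> X A G xs)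
  then show ?case by (meson nd2.AllE2_so)
next
  case (ExI2_fo \<Gamma> x t A)
  then show ?case by (meson nd2.ExI2_fo)
next
  case (ExI2_so \<Gamma> X xs G A)
  then show ?case by (meson nd2.ExI2_so)
next
  case (ExE2 \<Gamma> \<chi> A C)
  then obtain \<Delta> \<Delta>' where *: "\<Delta> \<subseteq> \<Gamma>" "finite \<Delta>" "nd2 S k \<Delta> (Ex2 \<chi> A)"
    "\<Delta>' \<subseteq> insert A \<Gamma>" "finite \<Delta>'" "nd2 S k \<Delta>' C" by blast
  let ?\<Delta> = "\<Delta> \<union> (\<Delta>' - {A})"
  have "nd2 S k ?\<Delta> C"
    by (rule nd2.ExE2[OF nd2.Weak2[OF *(3)] nd2.Weak2[OF *(6)]]) (use ExE2.hyps(3) * in auto)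
  then show ?case using * by (intro exI[of _ ?\<Delta>]) auto
qed

lemma nd2_cod:
  fixes S :: "'f sig"
  assumes bij: "\<And>n. bij_betw (\<phi> n) {X. arity X = n} UNIV"
    and "nd2 S k \<Gamma> A" "finite \<Gamma>" "\<And>\<zeta>. is_trm S (r \<zeta>)"
  shows "nd1 S k (cod r ` \<Gamma> \<union> SC1 S \<phi>) (cod r A)"
  using assms(2-)
proof (induction arbitrary: r rule: nd2.induct)
  case (Assm2 A \<Gamma>)
  then show ?case by (auto intro: Assm1 simp: is_fm1_cod)
next
  case (Weak2 \<Gamma> A \<Delta>)
  then have "nd1 S k (cod r ` \<Gamma> \<union> SC1 S \<phi>) (cod r A)" by (auto intro: finite_subset)
  then show ?case using Weak2.hyps by (auto elim!: Weak1)
next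
  case (BotE2 \<Gamma> A)
  then show ?case using BotE1[of S k _ "cod r A"] by (simp add: is_fm1_cod)
next
  case (RAA2 A \<Gamma>)
  then show ?case using RAA1[of k S "cod r A"] by (simp add: is_fm1_cod)
next
  case (ImpI2 A \<Gamma> B)
  then show ?case by (auto intro!: ImpI1 simp: is_fm1_cod)
next
  case (ImpE2 \<Gamma> A B)
  then show ?case using ImpE1[of S k _ "cod r A" "cod r B"] by simp
next
  case (AndI2 \<Gamma> A B)
  then show ?case by (auto intro: AndI1)
next
  case (AndE2l \<Gamma> A B)
  then show ?case using AndE1l[of S k _ "cod r A" "cod r B"] by simp
next
  case (AndE2r \<Gamma> A B)
  then show ?case using AndE1r[of S k _ "cod r A" "cod r B"] by simp
next
  case (OrI2l \<Gamma> A B)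
  then show ?case by (auto intro: OrI1l simp: is_fm1_cod)
next
  case (OrI2r \<Gamma> B A)
  then show ?case by (auto intro: OrI1r simp: is_fm1_cod)
next
  case (OrE2 \<Gamma> A B C)
  then show ?case using OrE1[of S k _ "cod r A" "cod r B" "cod r C"] by simp
next
  case (AllI2 \<Gamma> A \<chi>)
  let ?\<Gamma> = "cod r ` \<Gamma> \<union> SC1 S \<phi>"
  have "finite (\<Union>(Free1 ` ?\<Gamma>) \<union> (\<Union>\<zeta>\<in>Free2 A - {\<chi>}. vars (r \<zeta>)))"
    using finite_Free1_context[OF bij AllI2.prems(1)] by simp
  then obtain y where y: "y \<notin> \<Union>(Free1 ` ?\<Gamma>)" "y \<notin> (\<Union>\<zeta>\<in>Free2 A - {\<chi>}. vars (r \<zeta>))"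
    by (auto dest!: ex_new_if_finite[OF infinite_UNIV_nat] simp only: Un_iff)
  \<comment> \<open>The second-order eigenvariable condition is used here: changing \<open>r\<close>
    at \<open>\<chi>\<close> leaves the coded hypotheses as they are.\<close>
  have "cod (r(\<chi> := Var y)) B = cod r B" if "B \<in> \<Gamma>" for B
    using that AllI2.hyps by (intro cod_cong) auto
  then have eq: "cod (r(\<chi> := Var y)) ` \<Gamma> = cod r ` \<Gamma>" by simp
  have "nd1 S k (cod (r(\<chi> := Var y)) ` \<Gamma> \<union> SC1 S \<phi>) (cod (r(\<chi> := Var y)) A)"
    by (rule AllI2.IH) (use AllI2.prems in auto)
  then have "nd1 S k ?\<Gamma> (cod (r(\<chi> := Var y)) A)" by (simp only: eq)
  then show ?case using y by (rule cod_AllI)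
next
  case (AllE2_fo \<Gamma> x A t)
  let ?t = "tsubst (\<lambda>z. r (FO z)) t"
  have "nd1 S k (cod r ` \<Gamma> \<union> SC1 S \<phi>) (cod (r(FO x := ?t)) A)"
    using AllE2_fo by (intro cod_AllE) (simp_all add: is_trm_tsubst)
  then show ?case by (rule alpha_nd1) (rule alpha_sym[OF alpha_cod_fo_inst])
next
  case (ExI2_fo \<Gamma> x t A)
  let ?t = "tsubst (\<lambda>z. r (FO z)) t"
  have "nd1 S k (cod r ` \<Gamma> \<union> SC1 S \<phi>) (cod r (fo_inst x t A))" using ExI2_fo by blast
  then have "nd1 S k (cod r ` \<Gamma> \<union> SC1 S \<phi>) (cod (r(FO x := ?t)) A)"
    by (rule alpha_nd1) (rule alpha_cod_fo_inst)
  then show ?case by (rule cod_ExI) (simp_all add: is_trm_tsubst ExI2_fo.hyps ExI2_fo.prems)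
next
  case (AllE2_so \<Gamma> X A G xs)
  let ?\<Gamma> = "cod r ` \<Gamma> \<union> SC1 S \<phi>"
  have IH: "nd1 S k ?\<Gamma> (cod r (All2 (SO X) A))" using AllE2_so by blast
  \<comment> \<open>The rule has no premise that \<open>A\<close> is well-formed; this is recovered
    from the derived coding.\<close>
  then have fm: "is_fm2 S A" using AllE2_so.prems nd1_is_fm1 is_fm1_cod is_fm2.simps(6) by metis
  have fin: "finite (\<Union>(Free1 ` ?\<Gamma>))" using bij AllE2_so.prems(1) by (rule finite_Free1_context)
  show ?case
  proof (rule comprehension[OF bij _ fin AllE2_so.prems(2) fm AllE2_so.hyps(2-4)])
    fix y \<Delta>
    assume \<Delta>: "?\<Gamma> \<subseteq> \<Delta>"
      "nd1 S k \<Delta> (Iff1 (cod r (so_inst X (Lam xs G) A)) (cod (r(SO X := Var y)) A))"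
    \<comment> \<open>The universal formula is instantiated at the witness \<open>y\<close>, and the
      equivalence then exchanges \<open>y\<close> for the abstraction.\<close>
    have "nd1 S k \<Delta> (cod (r(SO X := Var y)) A)"
      using Weak1[OF IH \<Delta>(1)] by (rule cod_AllE) simp
    then show "nd1 S k \<Delta> (cod r (so_inst X (Lam xs G) A))" by (rule nd1_IffD2[OF \<Delta>(2)])
  qed simp
next
  case (ExI2_so \<Gamma> X xs G A)
  let ?\<Gamma> = "cod r ` \<Gamma> \<union> SC1 S \<phi>"
  have IH: "nd1 S k ?\<Gamma> (cod r (so_inst X (Lam xs G) A))" using ExI2_so by blast
  have fin: "finite (\<Union>(Free1 ` ?\<Gamma>))" using bij ExI2_so.prems(1) by (rule finite_Free1_context)
  show ?case
  proof (rule comprehension[OF bij _ fin ExI2_so.prems(2) ExI2_so.hyps(5,2-4)])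
    fix y \<Delta>
    assume \<Delta>: "?\<Gamma> \<subseteq> \<Delta>"
      "nd1 S k \<Delta> (Iff1 (cod r (so_inst X (Lam xs G) A)) (cod (r(SO X := Var y)) A))"
    \<comment> \<open>Here the equivalence leads from the abstraction to \<open>y\<close>, which
      becomes the existential witness.\<close>
    have "nd1 S k \<Delta> (cod (r(SO X := Var y)) A)"
      using Weak1[OF IH \<Delta>(1)] by (rule nd1_IffD1[OF \<Delta>(2)])
    then show "nd1 S k \<Delta> (cod r (Ex2 (SO X) A))"
      using ExI2_so by (intro cod_ExI) auto
  qed simp
next
  case (ExE2 \<Gamma> \<chi> A C)
  let ?\<Gamma> = "cod r ` \<Gamma> \<union> SC1 S \<phi>"
  have "finite (\<Union>(Free1 ` ?\<Gamma>) \<union> Free1 (cod r C) \<union> (\<Union>\<zeta>\<in>Free2 A - {\<chi>}. vars (r \<zeta>)))"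
    using finite_Free1_context[OF bij ExE2.prems(1)] by simp
  then obtain y where y: "y \<notin> \<Union>(Free1 ` ?\<Gamma>) \<union> Free1 (cod r C)"
    "y \<notin> (\<Union>\<zeta>\<in>Free2 A - {\<chi>}. vars (r \<zeta>))"
    by (auto dest!: ex_new_if_finite[OF infinite_UNIV_nat] simp only: Un_iff)
  let ?r = "r(\<chi> := Var y)"
  have "cod ?r B = cod r B" if "B \<in> insert C \<Gamma>" for B
    using that ExE2.hyps by (intro cod_cong) auto
  then have eq: "cod ?r ` \<Gamma> = cod r ` \<Gamma>" "cod ?r C = cod r C" by simp_all
  have "nd1 S k (cod ?r ` insert A \<Gamma> \<union> SC1 S \<phi>) (cod ?r C)"
    by (rule ExE2.IH(2)) (use ExE2.prems in auto)
  then have "nd1 S k (insert (cod ?r A) ?\<Gamma>) (cod r C)" by (simp only: eq image_insert Un_insert_left)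
  moreover have "nd1 S k ?\<Gamma> (cod r (Ex2 \<chi> A))" using ExE2.IH(1) ExE2.prems by blast
  ultimately show ?case by (rule cod_ExE[OF _ _ y, rotated])
qed

theorem theorem1:
  fixes S :: "'f::countable sig"
    and \<phi> :: "nat \<Rightarrow> svar \<Rightarrow> var"
    and k :: logic
    and \<Gamma> :: "'f fm2 set"
    and A :: "'f fm2"
  assumes "\<And>n. bij_betw (\<phi> n) {X. arity X = n} UNIV"
    and "\<forall>F\<in>\<Gamma>. is_fm2 S F"
    and "is_fm2 S A"
    and "nd2 S k \<Gamma> A"
  shows "nd1 S k (code \<phi> ` \<Gamma> \<union> SC1 S \<phi>) (code \<phi> A)"
proof -
  let ?r = "cenv \<phi> :: lvar \<Rightarrow> 'f trm"
  have r: "is_trm S (?r \<zeta>)" for \<zeta> by (simp add: cenv_def)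
  obtain \<Delta> where \<Delta>: "\<Delta> \<subseteq> \<Gamma>" "finite \<Delta>" "nd2 S k \<Delta> A" using nd2_finite[OF assms(4)] by blast
  let ?\<Gamma> = "code \<phi> ` \<Gamma> \<union> SC1 S \<phi>"
  have "nd1 S k (cod ?r ` \<Delta> \<union> SC1 S \<phi>) (cod ?r A)"
    using assms(1) \<Delta>(3,2) r by (rule nd2_cod)
  then have "nd1 S k (cod ?r ` \<Delta> \<union> ?\<Gamma>) (cod ?r A)" by (rule Weak1) auto
  \<comment> \<open>Each hypothesis in relative coding follows by renaming from its form under
    \<open>code \<phi>\<close>; being finitely many, they can be cut.\<close>
  moreover have "nd1 S k ?\<Gamma> F" if F: "F \<in> cod ?r ` \<Delta>" for F
  proof -
    obtain B where B: "B \<in> \<Gamma>" "F = cod ?r B" using F \<Delta>(1) by blast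
    have al: "alpha (code \<phi> B) F" unfolding B(2) by (rule alpha_code[OF assms(1)])
    have "is_fm1 S F" using B assms(2) r by (simp add: is_fm1_cod)
    then have "nd1 S k ?\<Gamma> (code \<phi> B)" using B(1) alpha_is_fm1[OF al] by (intro Assm1) auto
    then show ?thesis using al by (rule alpha_nd1)
  qed
  ultimately have "nd1 S k ?\<Gamma> (cod ?r A)" using \<Delta>(2) by (rule nd1_cuts[OF finite_imageI, rotated 1])
  then show ?thesis by (rule alpha_nd1) (rule alpha_sym[OF alpha_code[OF assms(1)]])
qed

end
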